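(* Assume that the partial derivatives $\partial_x^\alpha \mathbf u$ with $|\alpha|\le 3$ and $\partial_t\partial_x^\beta\mathbf u$ with $|\beta|\le 2$ exist and are uniformly bounded on $\mathcal D\times\mathbb R^+$, and let $L_B,L_M>0$ be constants with $\|\mathbf B_{\mathbf u}\|_\infty\le L_B$ and $\|\mathbf M_{\mathbf u}\|_\infty\le L_M$. Assume $0<\epsilon<1/L_M$. Let $(\mathbf y,\mathbf w):[0,\delta)\to\mathbb R^{2n}$, $0<\delta\le\infty$, be a mild solution of the rescaled Maxey--Riley equation with initial data $(\mathbf y_0,\mathbf w_0)$, where $[0,\delta)$ is the maximal interval of existence of such solutions. Then: (i) For all $\tau\in[0,\delta)$, $$|\mathbf w(\tau)|\le |\mathbf w_0|\left[\sum_{j=1}^\infty(\epsilon L_M)^{j-1}\psi^{*j}(\tau)\right]+\epsilon L_B\,(1-\phi(\tau))+\frac{\epsilon^2L_ML_B}{1-\epsilon L_M},$$ where $\psi^{*j}$ denotes the $j$-fold convolution of $\psi$. Moreover, the series converges uniformly and is bounded for all $\tau$. (ii) $|\mathbf w(\tau)|$ is bounded for all $\tau\in[0,\delta)$; specifically, $$\sup_{0\le\tau<\delta}|\mathbf w(\tau)|\le\frac{|\mathbf w_0|+\epsilon L_B}{1-\epsilon L_M}.$$ (iii) If $\delta=\infty$, then $$\limsup_{\tau\to\infty}|\mathbf w(\tau)|\le\frac{\epsilon L_B}{1-\epsilon L_M}.$$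
   Context: Data: $n\in\{2,3\}$; $\mathcal D\subseteq\mathbb R^n$ is open; $\mathbb R^+=[0,\infty)$; $\mathbf u:\mathcal D\times\mathbb R^+\to\mathbb R^n$ is a given (dimensionless) fluid velocity field; $t_0\in\mathbb R^+$; $\mathbf g\in\mathbb R^n$ is a constant vector. Parameters: $R=2\rho_f/(\rho_f+2\rho_p)$ with $\rho_f,\rho_p>0$, $\kappa=\sqrt{9R/2}$, $\gamma=9R/(2\mathrm{Re})$ with $\mathrm{Re}>0$, and $\epsilon>0$. With $\frac{D}{Dt}=\partial_t+\mathbf u\cdot\nabla$, define on $\mathcal D\times\mathbb R^+$ $$\mathbf A_{\mathbf u}=\mathbf u+\tfrac{\gamma\epsilon}{6}\Delta\mathbf u,\qquad \mathbf M_{\mathbf u}=\nabla\mathbf u+\tfrac{\gamma\epsilon}{6}\nabla\Delta\mathbf u,$$ $$\mathbf B_{\mathbf u}=\left(\tfrac{3R}{2}-1\right)\left(\tfrac{D\mathbf u}{Dt}-\mathbf g\right)+\left(\tfrac{R}{20}-\tfrac16\right)\gamma\epsilon\tfrac{D}{Dt}\Delta\mathbf u-\tfrac{\gamma\epsilon}{6}\left[\nabla\mathbf u+\tfrac{\gamma\epsilon}{6}\nabla\Delta\mathbf u\right]\Delta\mathbf u .$$ In terms of the rescaled time $\tau$ (with $t=t_0+\epsilon\tau$), the symbols $\mathbf A_{\mathbf u}(\mathbf y,\tau),\mathbf B_{\mathbf u}(\mathbf y,\tau),\mathbf M_{\mathbf u}(\mathbf y,\tau)$ in the rescaled Maxey--Riley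 equation and in the integral equations stand for the fields $\mathbf A_{\mathbf u},\mathbf B_{\mathbf u},\mathbf M_{\mathbf u}$, respectively, evaluated at the point $(\mathbf y,t_0+\epsilon\tau)\in\mathcal D\times\mathbb R^+$. $|\cdot|$ is the Euclidean norm, $\|\cdot\|$ the induced operator norm of matrices, and $\|\cdot\|_\infty$ the supremum (over $\mathcal D\times\mathbb R^+$) of $|\cdot|$ or $\|\cdot\|$. The rescaled Maxey--Riley equation is $$\frac{d\mathbf y}{d\tau}=\epsilon[\mathbf w+\mathbf A_{\mathbf u}(\mathbf y,\tau)],\quad \frac{d\mathbf w}{d\tau}+\kappa\frac{d^{1/2}\mathbf w}{d\tau^{1/2}}+\mathbf w=\epsilon[-\mathbf M_{\mathbf u}(\mathbf y,\tau)\mathbf w+\mathbf B_{\mathbf u}(\mathbf y,\tau)],\quad \mathbf y(0)=\mathbf y_0,\ \mathbf w(0)=\mathbf w_0,$$ where $\frac{d^{1/2}\mathbf w}{d\tau^{1/2}}=\frac{d}{d\tau}\left(\frac1{\sqrt\pi}\int_0^\tau\frac{\mathbf w(s)}{\sqrt{\tau-s}}ds\right)$. The function $\psi:[0,\infty)\to\mathbb R$ is the continuous function whose Laplace transform is $\frac{1}{s+\kappa\sqrt s+1}$, and $\phi:[0,\infty)\to\mathbb R$ is the function with $\phi'=-\psi$, $\phi(0)=1$, i.e. $\phi(\tau)=1-\int_0^\tau\psi(s)\,ds$. Convolutions are $(f*g)(\tau)=\int_0^\tau f(\tau-s)g(s)\,ds$, with $\psi^{*1}=\psi$ and $\psi^{*j}=\psi^{*(j-1)}*\psi$.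 A mild solution on $[0,\delta)$ is a function $(\mathbf y,\mathbf w):[0,\delta)\to\mathbb R^{2n}$ (with $\mathbf y$ taking values in $\mathcal D$) satisfying, for all $\tau\in[0,\delta)$, $$\mathbf y(\tau)=\mathbf y_0+\epsilon\int_0^\tau\left[\mathbf w(s)+\mathbf A_{\mathbf u}(\mathbf y(s),s)\right]ds,$$ $$\mathbf w(\tau)=\psi(\tau)\mathbf w_0+\epsilon\int_0^\tau\psi(\tau-s)\left[-\mathbf M_{\mathbf u}(\mathbf y(s),s)\mathbf w(s)+\mathbf B_{\mathbf u}(\mathbf y(s),s)\right]ds,$$ the integrals being well defined. *)

theory Defs
  imports "HOL-Analysis.Analysis"
begin

text \<open>
  All integrals are Lebesgue integrals: integrability is \<open>absolutely_integrable_on\<close>, and for such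
  integrands the value \<open>integral\<close> is the Lebesgue integral.
\<close>

section \<open>Laplace transform, convolution, and the function \<open>\<phi>\<close>\<close>

definition has_laplace_transform :: "(real \<Rightarrow> real) \<Rightarrow> (real \<Rightarrow> real) \<Rightarrow> bool" where
  "has_laplace_transform f F \<longleftrightarrow>
     (\<forall>s>0. (\<lambda>t. exp (- (s * t)) * f t) absolutely_integrable_on {0..} \<and>
            integral {0..} (\<lambda>t. exp (- (s * t)) * f t) = F s)"

definition conv :: "(real \<Rightarrow> real) \<Rightarrow> (real \<Rightarrow> real) \<Rightarrow> real \<Rightarrow> real" where
  "conv f g = (\<lambda>\<tau>. integral {0..\<tau>} (\<lambda>s. f (\<tau> - s) * g s))"

text \<open>\<open>conv_power f j\<close> is the \<open>j\<close>-fold convolution of \<open>f\<close>, for \<open>j \<ge> 1\<close>; the value at \<open>j = 0\<close> is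
  a dummy.\<close>

definition conv_power :: "(real \<Rightarrow> real) \<Rightarrow> nat \<Rightarrow> real \<Rightarrow> real" where
  "conv_power f j = ((\<lambda>h. conv h f) ^^ (j - 1)) f"

definition phi :: "(real \<Rightarrow> real) \<Rightarrow> real \<Rightarrow> real" where
  "phi \<psi> \<tau> = 1 - integral {0..\<tau>} \<psi>"

section \<open>Differential operators on time-dependent vector fields\<close>

type_synonym 'n field = "real ^ 'n \<Rightarrow> real \<Rightarrow> real ^ 'n"

definition dx :: "'n::finite \<Rightarrow> 'n field \<Rightarrow> 'n field" where
  "dx i f x t = vector_derivative (\<lambda>h. f (x + h *\<^sub>R axis i 1) t) (at 0)"

definition has_dx :: "(real ^ 'n) set \<Rightarrow> 'n::finite \<Rightarrow> 'n field \<Rightarrow> bool" where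
  "has_dx D i f \<longleftrightarrow> (\<forall>x\<in>D. \<forall>t\<ge>0. (\<lambda>h. f (x + h *\<^sub>R axis i 1) t) differentiable (at 0))"

text \<open>Time ranges over \<open>{0..}\<close>, so the time derivative at \<open>0\<close> is one-sided.\<close>

definition dt :: "'n::finite field \<Rightarrow> 'n field" where
  "dt f x t = vector_derivative (\<lambda>s. f x s) (at t within {0..})"

definition has_dt :: "(real ^ 'n) set \<Rightarrow> 'n::finite field \<Rightarrow> bool" where
  "has_dt D f \<longleftrightarrow> (\<forall>x\<in>D. \<forall>t\<ge>0. (\<lambda>s. f x s) differentiable (at t within {0..}))"

text \<open>Iterated spatial partial derivatives. A multi-index of order \<open>k\<close> is represented by lists of
  length \<open>k\<close> of coordinate directions (all orders of differentiation are considered).\<close>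

primrec dxs :: "'n::finite list \<Rightarrow> 'n field \<Rightarrow> 'n field" where
  "dxs [] f = f"
| "dxs (i # is) f = dx i (dxs is f)"

definition bounded_field :: "(real ^ 'n) set \<Rightarrow> 'n::finite field \<Rightarrow> bool" where
  "bounded_field D f \<longleftrightarrow> bounded ((\<lambda>(x, t). f x t) ` (D \<times> {0..}))"

definition bounded_partials :: "(real ^ 'n) set \<Rightarrow> 'n::finite field \<Rightarrow> bool" where
  "bounded_partials D u \<longleftrightarrow>
     (\<forall>is i. length is \<le> 2 \<longrightarrow> has_dx D i (dxs is u)) \<and>
     (\<forall>is. length is \<le> 3 \<longrightarrow> bounded_field D (dxs is u)) \<and>
     (\<forall>is. length is \<le> 2 \<longrightarrow> has_dt D (dxs is u) \<and> bounded_field D (dt (dxs is u)))"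

definition laplacian :: "'n::finite field \<Rightarrow> 'n field" where
  "laplacian f x t = (\<Sum>i\<in>UNIV. dx i (dx i f) x t)"

text \<open>The Jacobian matrix, with entry \<open>\<partial>\<^sub>j f\<^sub>i\<close> in row \<open>i\<close> and column \<open>j\<close>.\<close>

definition nabla :: "'n::finite field \<Rightarrow> real ^ 'n \<Rightarrow> real \<Rightarrow> real ^ 'n ^ 'n" where
  "nabla f x t = (\<chi> i j. dx j f x t $ i)"

definition material_deriv :: "'n::finite field \<Rightarrow> 'n field \<Rightarrow> 'n field" where
  "material_deriv u f x t = dt f x t + (\<Sum>i\<in>UNIV. (u x t $ i) *\<^sub>R dx i f x t)"

section \<open>The coefficient fields of the Maxey--Riley equation\<close>

definition A_field :: "real \<Rightarrow> real \<Rightarrow> 'n::finite field \<Rightarrow> 'n field" where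
  "A_field \<gamma> \<epsilon> u x t = u x t + (\<gamma> * \<epsilon> / 6) *\<^sub>R laplacian u x t"

definition M_field ::
  "real \<Rightarrow> real \<Rightarrow> 'n::finite field \<Rightarrow> real ^ 'n \<Rightarrow> real \<Rightarrow> real ^ 'n ^ 'n" where
  "M_field \<gamma> \<epsilon> u x t = nabla u x t + (\<gamma> * \<epsilon> / 6) *\<^sub>R nabla (laplacian u) x t"

definition B_field ::
  "real \<Rightarrow> real \<Rightarrow> real \<Rightarrow> real ^ 'n \<Rightarrow> 'n::finite field \<Rightarrow> 'n field" where
  "B_field R \<gamma> \<epsilon> g u x t =
     (3 * R / 2 - 1) *\<^sub>R (material_deriv u u x t - g)
     + ((R / 20 - 1 / 6) * \<gamma> * \<epsilon>) *\<^sub>R material_deriv u (laplacian u) x t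
     - (\<gamma> * \<epsilon> / 6) *\<^sub>R
         ((nabla u x t + (\<gamma> * \<epsilon> / 6) *\<^sub>R nabla (laplacian u) x t) *v laplacian u x t)"

text \<open>Suprema over \<open>D \<times> {0..}\<close> are taken in the extended reals, so that an upper bound on the norm
  includes the boundedness of the field.\<close>

definition vector_sup_norm :: "(real ^ 'n) set \<Rightarrow> 'n::finite field \<Rightarrow> ereal" where
  "vector_sup_norm D f = (SUP (x, t) \<in> D \<times> {0..}. ereal (norm (f x t)))"

definition matrix_sup_norm ::
  "(real ^ 'n) set \<Rightarrow> (real ^ 'n \<Rightarrow> real \<Rightarrow> real ^ 'n::finite ^ 'n) \<Rightarrow> ereal" where
  "matrix_sup_norm D F = (SUP (x, t) \<in> D \<times> {0..}. ereal (onorm ((*v) (F x t))))"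

section \<open>Mild solutions of the rescaled equation\<close>

definition time_interval :: "ereal \<Rightarrow> real set" where
  "time_interval \<delta> = {\<tau>. 0 \<le> \<tau> \<and> ereal \<tau> < \<delta>}"

text \<open>The fields \<open>A\<close>, \<open>M\<close>, \<open>B\<close> depend on the original time \<open>t = t\<^sub>0 + \<epsilon> \<tau>\<close>; values of \<open>y\<close> and \<open>w\<close>
  outside \<open>time_interval \<delta>\<close> are irrelevant.\<close>

definition mild_solution ::
  "(real ^ 'n) set \<Rightarrow> real \<Rightarrow> real \<Rightarrow> (real \<Rightarrow> real) \<Rightarrow>
   'n::finite field \<Rightarrow> (real ^ 'n \<Rightarrow> real \<Rightarrow> real ^ 'n ^ 'n) \<Rightarrow> 'n field \<Rightarrow>
   real ^ 'n \<Rightarrow> real ^ 'n \<Rightarrow> ereal \<Rightarrow> (real \<Rightarrow> real ^ 'n) \<Rightarrow> (real \<Rightarrow> real ^ 'n) \<Rightarrow> bool" where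
  "mild_solution D t0 \<epsilon> \<psi> A M B y0 w0 \<delta> y w \<longleftrightarrow>
     (\<forall>\<tau>\<in>time_interval \<delta>.
        y \<tau> \<in> D \<and>
        (\<lambda>s. w s + A (y s) (t0 + \<epsilon> * s)) absolutely_integrable_on {0..\<tau>} \<and>
        y \<tau> = y0 + \<epsilon> *\<^sub>R integral {0..\<tau>} (\<lambda>s. w s + A (y s) (t0 + \<epsilon> * s)) \<and>
        (\<lambda>s. \<psi> (\<tau> - s) *\<^sub>R (- (M (y s) (t0 + \<epsilon> * s) *v w s) + B (y s) (t0 + \<epsilon> * s)))
          absolutely_integrable_on {0..\<tau>} \<and>
        w \<tau> = \<psi> \<tau> *\<^sub>R w0 + \<epsilon> *\<^sub>R integral {0..\<tau>}
          (\<lambda>s. \<psi> (\<tau> - s) *\<^sub>R (- (M (y s) (t0 + \<epsilon> * s) *v w s) + B (y s) (t0 + \<epsilon> * s))))"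

definition maximal_mild_solution ::
  "(real ^ 'n) set \<Rightarrow> real \<Rightarrow> real \<Rightarrow> (real \<Rightarrow> real) \<Rightarrow>
   'n::finite field \<Rightarrow> (real ^ 'n \<Rightarrow> real \<Rightarrow> real ^ 'n ^ 'n) \<Rightarrow> 'n field \<Rightarrow>
   real ^ 'n \<Rightarrow> real ^ 'n \<Rightarrow> ereal \<Rightarrow> (real \<Rightarrow> real ^ 'n) \<Rightarrow> (real \<Rightarrow> real ^ 'n) \<Rightarrow> bool" where
  "maximal_mild_solution D t0 \<epsilon> \<psi> A M B y0 w0 \<delta> y w \<longleftrightarrow>
     mild_solution D t0 \<epsilon> \<psi> A M B y0 w0 \<delta> y w \<and>
     \<not> (\<exists>\<delta>' y' w'. \<delta> < \<delta>' \<and> mild_solution D t0 \<epsilon> \<psi> A M B y0 w0 \<delta>' y' w' \<and>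
          (\<forall>\<tau>\<in>time_interval \<delta>. y' \<tau> = y \<tau> \<and> w' \<tau> = w \<tau>))"

end

theory Submission
  imports Defs
begin

text \<open>
  Let \<open>k(x) = 1 + \<kappa> / sqrt (\<pi> x)\<close>, whose Laplace transform is \<open>1/s + \<kappa> / sqrt s\<close>. By the
  convolution theorem and Lerch's uniqueness theorem, \<open>\<psi>\<close> solves the Volterra equation
  \<open>\<psi> + k * \<psi> = 1\<close>. As \<open>k\<close> is decreasing, \<open>\<psi>\<close> cannot have a negative minimum, so \<open>\<psi> \<ge> 0\<close>; then
  \<open>k \<ge> 1\<close> gives \<open>\<psi> \<le> 1\<close> and \<open>\<integral>\<psi> \<le> 1\<close>, and the modulus of continuity of \<open>k * \<psi>\<close>
  gives \<open>\<psi> \<rightarrow> 0\<close> at infinity. Every convolution power of \<open>\<psi>\<close> inherits these properties, and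
  \<open>|w| \<le> |w0| \<psi> + \<epsilon> \<psi> * (L_M |w| + L_B)\<close> is iterated, the remainder after \<open>N\<close> steps being of
  order \<open>(\<epsilon> L_M)^N\<close>.
\<close>

section \<open>Uniqueness and convolution theorem for the Laplace transform\<close>

text \<open>Inverting the transform by partial fractions in sqrt s meets the roots of x^2 + \<kappa>
  x + 1, complex for \<kappa> < 2 and real otherwise; both cases occur, since 0 < R < 2 gives 0 <
  \<kappa> < 3, and the sign of \<psi> is hard to read off such formulas. The Volterra equation
  treats all \<kappa> \<ge> 0 alike. Its price is the singularity of the kernel at 0, which is
  handled through a continuous primitive. Nonnegativity of \<psi> is what lets norms pass under the
  convolution without loss: the L1 norm of \<psi> is then at most 1, so each iteration contracts by
  exactly \<epsilon> L_M, with no further constant. The definition of a mild solution does not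
  include continuity of w, so |w| itself is never convolved. The iteration runs through continuous
  majorants of |w| instead, and it has to start from some bounded one; that start is drawn from the
  integrability demanded in the equation for y.\<close>

lemma absolutely_integrable_continuous_bounded_mult:
  fixes f c :: "real \<Rightarrow> real"
  assumes "f absolutely_integrable_on S" "continuous_on S c" "S \<in> sets lebesgue"
    and "\<And>x. x \<in> S \<Longrightarrow> \<bar>c x\<bar> \<le> K"
  shows "(\<lambda>x. c x * f x) absolutely_integrable_on S"
proof (rule absolutely_integrable_bounded_measurable_product_real)
  show "c \<in> borel_measurable (lebesgue_on S)"
    using assms by (intro continuous_imp_measurable_on_sets_lebesgue)
  show "bounded (c ` S)"
    using assms(4) by (auto simp: bounded_iff)
qed (use assms in auto)

text \<open>In the variable x = exp (-t) the values of the transform at 1, 2, ... are moments. One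
  factor exp (-t) stays with \<open>h\<close> as an integrable weight, so \<open>q\<close> may have
  a constant term.\<close>

lemma has_integral_polynomial_exp_zero:
  fixes h q :: "real \<Rightarrow> real"
  assumes "real_polynomial_function q"
    and "\<And>n::nat. ((\<lambda>t. exp (- (real (Suc n) * t)) * h t) has_integral 0) {0..}"
  shows "((\<lambda>t. q (exp (- t)) * (exp (- t) * h t)) has_integral 0) {0..}"
proof -
  obtain a n where q: "q = (\<lambda>x. \<Sum>i\<le>n. a i * x ^ i)"
    using real_polynomial_function_imp_sum assms(1) by blast
  have "((\<lambda>t. \<Sum>i\<le>n. a i * (exp (- (real (Suc i) * t)) * h t)) has_integral (\<Sum>i\<le>n. a i * 0)) {0..}"
    by (intro has_integral_sum has_integral_mult_right assms(2)) auto
  moreover have "a i * (exp (- (real (Suc i) * t)) * h t) = a i * exp (- t) ^ i * (exp (- t) * h t)" for i t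
  proof -
    have "exp (- (real (Suc i) * t)) = exp (- t) ^ i * exp (- t)"
      by (simp add: exp_of_nat_mult[symmetric] exp_add[symmetric] algebra_simps)
    then show ?thesis by (metis mult.assoc)
  qed
  ultimately show ?thesis
    by (simp only: q sum_distrib_right mult_zero_right sum.neutral_const)
qed

text \<open>Since exp (-t) stays in \<open>{0..1}\<close>, Stone-Weierstrass replaces
  \<open>c\<close> by a polynomial, whose integral vanishes; the error is at most \<open>e\<close>
  times the L1 norm of the weight.\<close>

lemma laplace_transform_zero_test:
  fixes h c :: "real \<Rightarrow> real"
  assumes int: "\<And>p. p > 0 \<Longrightarrow> (\<lambda>t. exp (- (p * t)) * h t) absolutely_integrable_on {0..}"
    and zero: "\<And>p. p > 0 \<Longrightarrow> integral {0..} (\<lambda>t. exp (- (p * t)) * h t) = 0"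
    and c: "continuous_on {0..1} c"
  shows "((\<lambda>t. c (exp (- t)) * (exp (- t) * h t)) has_integral 0) {0..}"
proof -
  let ?f = "\<lambda>t. exp (- t) * h t"
  have f: "?f absolutely_integrable_on {0..}"
    using int[of 1] by simp
  have hi: "((\<lambda>t. exp (- (real (Suc n) * t)) * h t) has_integral 0) {0..}" for n
    by (rule has_integral_eq_rhs[OF integrable_integral[OF set_lebesgue_integral_eq_integral(1)[OF int]]])
       (auto intro!: zero)
  have cint: "(\<lambda>t. b (exp (- t)) * ?f t) absolutely_integrable_on {0..}"
    if b: "continuous_on {0..1} b" for b :: "real \<Rightarrow> real"
  proof -
    have "compact (b ` {0..1})"
      using b by (intro compact_continuous_image) auto
    then have "bounded (b ` {0..1})"
      by (rule compact_imp_bounded)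
    then obtain K where K: "\<And>x. x \<in> {0..1} \<Longrightarrow> \<bar>b x\<bar> \<le> K"
      unfolding bounded_iff by (metis imageI real_norm_def)
    show ?thesis
    proof (rule absolutely_integrable_continuous_bounded_mult[OF f, where K = K])
      show "continuous_on {0..} (\<lambda>t. b (exp (- t)))"
        by (rule continuous_on_compose2[OF b]) (auto intro!: continuous_intros)
    qed (use K in auto)
  qed
  define L where "L = integral {0..} (\<lambda>t. \<bar>?f t\<bar>)"
  have L: "(\<lambda>t. \<bar>?f t\<bar>) integrable_on {0..}"
    using f by (simp add: absolutely_integrable_on_def)
  have bnd: "\<bar>integral {0..} (\<lambda>t. c (exp (- t)) * ?f t)\<bar> \<le> e * L" if "e > 0" for e
  proof -
    obtain q where q: "real_polynomial_function q" "\<And>x. x \<in> {0..1} \<Longrightarrow> \<bar>c x - q x\<bar> < e"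
      using Stone_Weierstrass_real_polynomial_function[OF _ c \<open>e > 0\<close>] by (metis compact_Icc)
    have qc: "continuous_on {0..1} q"
      using q(1) by (simp add: continuous_on_polymonial_function real_polynomial_function_eq)
    have d: "(\<lambda>t. (c (exp (- t)) - q (exp (- t))) * ?f t) integrable_on {0..}"
      using cint[of "\<lambda>x. c x - q x"] c qc
      by (intro set_lebesgue_integral_eq_integral(1)) (auto intro: continuous_intros)
    have "integral {0..} (\<lambda>t. c (exp (- t)) * ?f t)
        = integral {0..} (\<lambda>t. (c (exp (- t)) - q (exp (- t))) * ?f t + q (exp (- t)) * ?f t)"
      by (simp add: algebra_simps)
    also have "\<dots> = integral {0..} (\<lambda>t. (c (exp (- t)) - q (exp (- t))) * ?f t)"
      using has_integral_polynomial_exp_zero[OF q(1) hi] d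
      by (subst Henstock_Kurzweil_Integration.integral_add) (auto simp: integral_unique has_integral_integrable)
    also have "norm \<dots> \<le> integral {0..} (\<lambda>t. e * \<bar>?f t\<bar>)"
    proof (rule Henstock_Kurzweil_Integration.integral_norm_bound_integral[OF d])
      show "(\<lambda>t. e * \<bar>?f t\<bar>) integrable_on {0..}"
        using L by (rule integrable_on_mult_right)
      fix t :: real assume "t \<in> {0..}"
      then have "\<bar>c (exp (- t)) - q (exp (- t))\<bar> \<le> e"
        using q(2)[of "exp (- t)"] by simp
      then have "\<bar>c (exp (- t)) - q (exp (- t))\<bar> * \<bar>?f t\<bar> \<le> e * \<bar>?f t\<bar>"
        by (rule mult_right_mono) simp
      then show "norm ((c (exp (- t)) - q (exp (- t))) * ?f t) \<le> e * \<bar>?f t\<bar>"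
        by (simp only: real_norm_def abs_mult)
    qed
    also have "\<dots> = e * L"
      by (simp add: L_def)
    finally show ?thesis by simp
  qed
  have "\<bar>integral {0..} (\<lambda>t. c (exp (- t)) * ?f t)\<bar> \<le> 0"
  proof (rule field_le_epsilon)
    fix e :: real assume *: "0 < e"
    have "0 \<le> L"
      unfolding L_def by (intro Henstock_Kurzweil_Integration.integral_nonneg L) auto
    \<comment> \<open>Dividing by \<open>L + 1\<close> rather than \<open>L\<close> covers a weight
      of norm 0.\<close>
    then have "e / (L + 1) * L \<le> e" using * by (simp add: field_simps)
    with bnd[of "e / (L + 1)"] * \<open>0 \<le> L\<close>
    show "\<bar>integral {0..} (\<lambda>t. c (exp (- t)) * ?f t)\<bar> \<le> 0 + e"
      by simp
  qed
  with cint[OF c] show ?thesis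
    by (metis abs_le_zero_iff integrable_integral set_lebesgue_integral_eq_integral(1))
qed

text \<open>A hat function \<open>c\<close> centred at \<open>exp (- t1)\<close> localises the test integral at \<open>t1\<close>.\<close>

lemma laplace_transform_zero_nonpos:
  fixes h :: "real \<Rightarrow> real"
  assumes int: "\<And>p. p > 0 \<Longrightarrow> (\<lambda>t. exp (- (p * t)) * h t) absolutely_integrable_on {0..}"
    and zero: "\<And>p. p > 0 \<Longrightarrow> integral {0..} (\<lambda>t. exp (- (p * t)) * h t) = 0"
    and h: "continuous_on {0..} h" and "t1 \<ge> 0"
  shows "h t1 \<le> 0"
proof (rule ccontr)
  assume "\<not> h t1 \<le> 0"
  then have "h t1 > 0" by simp
  then obtain d where d: "d > 0" "\<And>t. t \<ge> 0 \<Longrightarrow> dist t t1 < d \<Longrightarrow> h t > 0"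
  proof -
    obtain d where "d > 0" "\<forall>t\<in>{0..}. dist t t1 < d \<longrightarrow> dist (h t) (h t1) < h t1"
      using h \<open>h t1 > 0\<close> \<open>t1 \<ge> 0\<close> unfolding continuous_on_iff by (metis atLeast_iff)
    with \<open>h t1 > 0\<close> show ?thesis
      by (intro that[of d]) (auto simp: dist_real_def abs_if split: if_splits)
  qed
  \<comment> \<open>Turns the radius \<open>d\<close> in t into a radius \<open>r\<close> in exp
    (-t), so that the hat is supported where \<open>h\<close> is positive.\<close>
  have "isCont ln (exp (- t1))"
    by (auto intro: isCont_ln')
  then obtain r where r: "r > 0" "\<And>x. dist x (exp (- t1)) < r \<Longrightarrow> dist (ln x) (- t1) < d"
    using d(1) by (auto simp: continuous_at_eps_delta dist_real_def)
  define c where "c = (\<lambda>x. max 0 (r - \<bar>x - exp (- t1)\<bar>))"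
  let ?f = "\<lambda>t. c (exp (- t)) * (exp (- t) * h t)"
  have c: "continuous_on A c" for A
    unfolding c_def by (intro continuous_intros)
  have f0: "(?f has_integral 0) {0..}"
    by (rule laplace_transform_zero_test[OF int zero c])
  have pos: "0 \<le> ?f t" if "t \<ge> 0" for t
  proof (cases "dist (exp (- t)) (exp (- t1)) < r")
    case True
    from r(2)[OF this] have "h t > 0"
      using that by (intro d(2)) (auto simp: dist_real_def)
    then show ?thesis by (simp add: c_def)
  qed (simp add: c_def dist_real_def)
  have cf: "continuous_on {0..t1 + 1} ?f"
    by (intro continuous_intros continuous_on_subset[OF h] continuous_on_compose2[OF c[of UNIV]]) auto
  have "integral {0..t1 + 1} ?f \<le> integral {0..} ?f"
    using f0 cf pos by (intro integral_subset_le) (auto intro: integrable_continuous_interval)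
  moreover have "integral {0..t1 + 1} ?f \<ge> 0"
    using cf pos by (intro Henstock_Kurzweil_Integration.integral_nonneg) (auto intro: integrable_continuous_interval)
  ultimately have "integral {0..t1 + 1} ?f = 0"
    using f0 by (simp add: integral_unique)
  then have "(?f has_integral 0) (cbox 0 (t1 + 1))"
    using cf by (metis box_real(2) integrable_continuous_interval integrable_integral)
  then have "?f t1 = 0"
    using cf \<open>t1 \<ge> 0\<close> pos by (intro has_integral_0_cbox_imp_0[of 0 "t1 + 1" ?f]) auto
  with \<open>h t1 > 0\<close> r(1) show False
    by (simp add: c_def)
qed

lemma laplace_transform_zero:
  fixes h :: "real \<Rightarrow> real"
  assumes int: "\<And>p. p > 0 \<Longrightarrow> (\<lambda>t. exp (- (p * t)) * h t) absolutely_integrable_on {0..}"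
    and zero: "\<And>p. p > 0 \<Longrightarrow> integral {0..} (\<lambda>t. exp (- (p * t)) * h t) = 0"
    and h: "continuous_on {0..} h" and "t \<ge> 0"
  shows "h t = 0"
proof (rule antisym)
  show "h t \<le> 0"
    by (rule laplace_transform_zero_nonpos[OF assms])
  have "- h t \<le> 0"
    using int zero h \<open>t \<ge> 0\<close>
    by (intro laplace_transform_zero_nonpos[of "\<lambda>t. - h t"])
       (auto intro: continuous_intros simp: set_integrable_def)
  then show "0 \<le> h t" by simp
qed

text \<open>Fubini and translation invariance on the whole line. Half-line convolutions arise by
  giving both factors the indicator of \<open>{0..}\<close>.\<close>

lemma convolution_integrable_lborel:
  fixes F G :: "real \<Rightarrow> real"
  assumes F: "integrable lborel F" and G: "integrable lborel G"
  shows "integrable lborel (\<lambda>t. \<integral>s. F (t - s) * G s \<partial>lborel)"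
    and "(\<integral>t. (\<integral>s. F (t - s) * G s \<partial>lborel) \<partial>lborel) = (\<integral>t. F t \<partial>lborel) * (\<integral>t. G t \<partial>lborel)"
proof -
  have [measurable]: "F \<in> borel_measurable borel" "G \<in> borel_measurable borel"
    using F G by (simp_all add: borel_measurable_integrable)
  have Fs: "integrable lborel (\<lambda>t. F (t - s))" for s
    using lborel_integrable_real_affine[OF F, of 1 "- s"] by simp
  have Fi: "(\<integral>t. F (t - s) \<partial>lborel) = (\<integral>t. F t \<partial>lborel)" for s
    using lborel_integral_real_affine[of 1 F "- s"] by simp
  have FAi: "(\<integral>t. \<bar>F (t - s)\<bar> \<partial>lborel) = (\<integral>t. \<bar>F t\<bar> \<partial>lborel)" for s
    using lborel_integral_real_affine[of 1 "\<lambda>t. \<bar>F t\<bar>" "- s"] by simp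
  have I: "integrable (lborel \<Otimes>\<^sub>M lborel) (\<lambda>(s, t). F (t - s) * G s)"
  proof (rule lborel_pair.Fubini_integrable)
    show "integrable lborel (\<lambda>s. \<integral>t. norm (case (s, t) of (s, t) \<Rightarrow> F (t - s) * G s) \<partial>lborel)"
      using G by (simp add: abs_mult FAi)
  qed (use Fs in auto)
  show "integrable lborel (\<lambda>t. \<integral>s. F (t - s) * G s \<partial>lborel)"
    using lborel_pair.integrable_snd[OF I] by simp
  have "(\<integral>t. (\<integral>s. F (t - s) * G s \<partial>lborel) \<partial>lborel) = (\<integral>s. (\<integral>t. F (t - s) * G s \<partial>lborel) \<partial>lborel)"
    using lborel_pair.Fubini_integral[OF I] by simp
  also have "\<dots> = (\<integral>t. F t \<partial>lborel) * (\<integral>t. G t \<partial>lborel)"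
    by (simp add: Fi)
  finally show "(\<integral>t. (\<integral>s. F (t - s) * G s \<partial>lborel) \<partial>lborel) = (\<integral>t. F t \<partial>lborel) * (\<integral>t. G t \<partial>lborel)" .
qed

section \<open>The Volterra equation for \<open>\<psi>\<close>\<close>

text \<open>Division by zero makes the value at 0 equal to 1. This respects the lower bound 1 on the
  half-line but not monotonicity, which is therefore claimed for positive arguments only.\<close>

definition volterra_kernel :: "real \<Rightarrow> real \<Rightarrow> real" where
  "volterra_kernel \<kappa> x = 1 + \<kappa> / (sqrt pi * sqrt x)"

definition volterra_kernel_primitive :: "real \<Rightarrow> real \<Rightarrow> real" where
  "volterra_kernel_primitive \<kappa> x = x + 2 * \<kappa> * sqrt x / sqrt pi"

text \<open>An instance of \<open>conv\<close> under its own name: the lemmas on \<open>conv\<close>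
  ask for factors continuous on \<open>{0..}\<close>, while this kernel is in general singular at 0
  and is integrable by way of its primitive.\<close>

definition volterra_conv :: "real \<Rightarrow> (real \<Rightarrow> real) \<Rightarrow> real \<Rightarrow> real" where
  "volterra_conv \<kappa> f t = integral {0..t} (\<lambda>s. volterra_kernel \<kappa> (t - s) * f s)"

lemma has_bochner_integral_Gamma:
  fixes x :: real
  assumes "x > 0"
  shows "has_bochner_integral lborel (\<lambda>t. indicator {0..} t * (t powr (x - 1) / exp t)) (Gamma x)"
proof (rule has_bochner_integral_nn_integral)
  show "(\<integral>\<^sup>+ t. ennreal (indicator {0..} t * (t powr (x - 1) / exp t)) \<partial>lborel) = ennreal (Gamma x)"
    by (simp add: Gamma_conv_nn_integral_real[OF assms])
qed (use assms in \<open>auto simp: Gamma_real_pos less_imp_le\<close>)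

text \<open>Scaling t by p reduces both terms to Euler integrals, and the sqrt pi in the kernel
  cancels Gamma (1/2). The case \<kappa> = 0 serves as the transform of the constant 1.\<close>

lemma has_bochner_integral_volterra_kernel_laplace:
  assumes p: "p > 0"
  shows "has_bochner_integral lborel (\<lambda>t. indicator {0..} t * (exp (- (p * t)) * volterra_kernel \<kappa> t))
           (1 / p + \<kappa> / sqrt p)"
proof -
  let ?e = "\<lambda>x t. indicator {0..} (p * t) * ((p * t) powr (x - 1) / exp (p * t))"
  have e: "has_bochner_integral lborel (?e x) (Gamma x / p)" if "x > 0" for x :: real
    using has_bochner_integral_Gamma[OF that] p
      lborel_has_bochner_integral_real_affine_iff[of p _ "Gamma x" 0]
    by (simp add: divide_inverse_commute)
  have "has_bochner_integral lborel (\<lambda>t. ?e 1 t + \<kappa> * sqrt p / sqrt pi * ?e (1/2) t)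
      (Gamma 1 / p + \<kappa> * sqrt p / sqrt pi * (Gamma (1/2) / p))"
    by (intro has_bochner_integral_add has_bochner_integral_mult_right e) auto
  also have "Gamma 1 / p + \<kappa> * sqrt p / sqrt pi * (Gamma (1/2) / p) = 1 / p + \<kappa> / sqrt p"
    using p by (simp add: Gamma_one_half_real field_simps)
  finally have *: "has_bochner_integral lborel (\<lambda>t. ?e 1 t + \<kappa> * sqrt p / sqrt pi * ?e (1/2) t)
      (1 / p + \<kappa> / sqrt p)" .
  \<comment> \<open>The integrands differ at 0: \<open>0 powr x = 0\<close> makes the left side 0,
    while the right side is 1.\<close>
  have "AE t in lborel. t \<noteq> (0::real)"
    by (rule AE_lborel_singleton)
  then have "AE t in lborel. ?e 1 t + \<kappa> * sqrt p / sqrt pi * ?e (1/2) t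
      = indicator {0..} t * (exp (- (p * t)) * volterra_kernel \<kappa> t)"
  proof eventually_elim
    case (elim t)
    show ?case
    proof (cases "t > 0")
      case True
      with p have "(p * t) powr (- (1/2)) = 1 / (sqrt p * sqrt t)"
        by (simp add: powr_minus powr_half_sqrt real_sqrt_mult divide_simps)
      with True p show ?thesis
        by (simp add: volterra_kernel_def exp_minus field_simps)
    qed (use elim p in \<open>auto simp: zero_le_mult_iff\<close>)
  qed
  with * show ?thesis
    by (subst has_bochner_integral_cong_AE[symmetric]) (auto simp: volterra_kernel_def)
qed

section \<open>Estimates for the kernel and its convolution operator\<close>

locale nonneg_kernel_param =
  fixes \<kappa> :: real
  assumes kappa_nonneg: "0 \<le> \<kappa>"
begin

abbreviation "k \<equiv> volterra_kernel \<kappa>"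
abbreviation "G \<equiv> volterra_kernel_primitive \<kappa>"

lemma kernel_ge_1: "0 \<le> x \<Longrightarrow> 1 \<le> k x"
  using kappa_nonneg by (simp add: volterra_kernel_def)

lemma kernel_nonneg: "0 \<le> x \<Longrightarrow> 0 \<le> k x"
  using kernel_ge_1[of x] by simp

lemma kernel_antimono: "0 < x \<Longrightarrow> x \<le> y \<Longrightarrow> k y \<le> k x"
  using kappa_nonneg by (auto simp: volterra_kernel_def intro!: divide_left_mono mult_left_mono)

lemma primitive_0 [simp]: "G 0 = 0"
  by (simp add: volterra_kernel_primitive_def)

lemma primitive_mono: "0 \<le> x \<Longrightarrow> x \<le> y \<Longrightarrow> G x \<le> G y"
  using kappa_nonneg
  by (auto simp: volterra_kernel_primitive_def intro!: add_mono divide_right_mono mult_left_mono)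

lemma continuous_primitive: "continuous_on A G"
  unfolding volterra_kernel_primitive_def by (intro continuous_intros) auto

lemma primitive_strict_mono: "0 \<le> x \<Longrightarrow> x < y \<Longrightarrow> G x < G y"
  using kappa_nonneg
  by (auto simp: volterra_kernel_primitive_def intro!: add_less_le_mono divide_right_mono mult_left_mono)

lemma primitive_small:
  assumes "e > 0"
  obtains d where "d > 0" "\<And>x. 0 \<le> x \<Longrightarrow> x \<le> d \<Longrightarrow> G x < e"
proof -
  have "isCont G 0"
    using continuous_primitive[of UNIV] by (simp add: continuous_on_eq_continuous_at)
  then obtain d where d: "d > 0" "\<And>x. \<bar>x\<bar> < d \<Longrightarrow> \<bar>G x\<bar> < e"
    using assms unfolding continuous_at_eps_delta by (auto simp: dist_real_def)
  show ?thesis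
  proof (rule that[of "d / 2"])
    fix x assume "0 \<le> x" "x \<le> d / 2"
    with d(1) d(2)[of x] show "G x < e" by linarith
  qed (use d in simp)
qed

lemma kernel_has_integral:
  assumes "a \<le> b" "b \<le> t"
  shows "((\<lambda>s. k (t - s)) has_integral (G (t - a) - G (t - b))) {a..b}"
proof -
  have "((\<lambda>s. k (t - s)) has_integral ((- G (t - b)) - (- G (t - a)))) {a..b}"
  \<comment> \<open>For positive \<kappa>, \<open>G\<close> has infinite slope at 0, that is at s =
    t when \<open>b = t\<close>; the interior form needs the derivative on the open interval
    only.\<close>
  proof (rule fundamental_theorem_of_calculus_interior)
    show "continuous_on {a..b} (\<lambda>s. - G (t - s))"
      by (intro continuous_intros continuous_on_compose2[OF continuous_primitive[of UNIV]]) auto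
    fix x assume "x \<in> {a<..<b}"
    with assms have "t - x > 0" by auto
    then show "((\<lambda>s. - G (t - s)) has_vector_derivative k (t - x)) (at x)"
      unfolding has_real_derivative_iff_has_vector_derivative[symmetric]
        volterra_kernel_primitive_def volterra_kernel_def
      by (auto intro!: derivative_eq_intros simp: field_simps)
  qed fact
  then show ?thesis by simp
qed

lemma kernel_mult_absolutely_integrable:
  assumes "continuous_on {a..b} f" "b \<le> t"
  shows "(\<lambda>s. k (t - s) * f s) absolutely_integrable_on {a..b}"
proof (cases "a \<le> b")
  case True
  have "bounded (f ` {a..b})"
    using assms by (intro compact_imp_bounded compact_continuous_image) auto
  then obtain K where K: "\<And>x. x \<in> {a..b} \<Longrightarrow> \<bar>f x\<bar> \<le> K"
    unfolding bounded_iff by (metis imageI real_norm_def)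
  have "(\<lambda>s. k (t - s)) absolutely_integrable_on {a..b}"
    using has_integral_integrable[OF kernel_has_integral[OF True assms(2)]] assms(2)
    by (intro nonnegative_absolutely_integrable_1 kernel_nonneg) auto
  then have "(\<lambda>s. f s * k (t - s)) absolutely_integrable_on {a..b}"
    using assms K by (intro absolutely_integrable_continuous_bounded_mult[where K = K]) auto
  then show ?thesis by (simp add: mult.commute)
qed auto

lemmas kernel_mult_integrable = set_lebesgue_integral_eq_integral(1)[OF kernel_mult_absolutely_integrable]

lemma volterra_conv_split:
  assumes "continuous_on {0..t} f" "0 \<le> s" "s \<le> t"
  shows "volterra_conv \<kappa> f t
       = integral {0..s} (\<lambda>r. k (t - r) * f r) + integral {s..t} (\<lambda>r. k (t - r) * f r)"
  unfolding volterra_conv_def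
  using assms by (intro Henstock_Kurzweil_Integration.integral_combine[symmetric] kernel_mult_integrable) auto

text \<open>Open intervals avoid the junk value of the kernel at its singularity 0.\<close>

lemma integral_kernel_shift_le:
  assumes "continuous_on {0..s} f" "s \<le> t" "\<And>r. r \<in> {0..s} \<Longrightarrow> 0 \<le> f r"
  shows "integral {0..s} (\<lambda>r. k (t - r) * f r) \<le> volterra_conv \<kappa> f s"
  unfolding volterra_conv_def integral_open_interval_real[of 0 s]
  using assms
  by (intro integral_le integrable_on_Icc_iff_Ioo[THEN iffD1] kernel_mult_integrable)
     (auto intro!: mult_right_mono kernel_antimono)

text \<open>Replacing k (s - r) by k (t - r) on \<open>{0..s}\<close> costs at most C times G s - G
  t + G (t - s), hence at most C G (t - s), because the kernel decreases. The new piece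
  \<open>{s..t}\<close> costs the same again. The estimate depends on t - s alone, so a bounded
  \<open>f\<close> yields uniform continuity on the whole half-line.\<close>

lemma volterra_conv_modulus:
  assumes f: "continuous_on {0..t} f" and bnd: "\<And>r. r \<in> {0..t} \<Longrightarrow> \<bar>f r\<bar> \<le> C"
    and s: "0 \<le> s" "s \<le> t"
  shows "\<bar>volterra_conv \<kappa> f t - volterra_conv \<kappa> f s\<bar> \<le> 2 * C * G (t - s)"
proof -
  have fs: "continuous_on {0..s} f"
    by (rule continuous_on_subset[OF f]) (use s in auto)
  have ft: "continuous_on {s..t} f"
    by (rule continuous_on_subset[OF f]) (use s in auto)
  have "C \<ge> 0" using bnd[of 0] s by auto
  have kd: "((\<lambda>r. k (s - r) - k (t - r)) has_integral (G s - (G t - G (t - s)))) {0..s}"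
    using has_integral_diff[OF kernel_has_integral[of 0 s s] kernel_has_integral[of 0 s t]] s
    by simp
  have kt: "((\<lambda>r. k (t - r)) has_integral G (t - s)) {s..t}"
    using kernel_has_integral[of s t t] s by simp
  have "\<bar>volterra_conv \<kappa> f s - integral {0..s} (\<lambda>r. k (t - r) * f r)\<bar>
      = norm (integral {0<..<s} (\<lambda>r. k (s - r) * f r - k (t - r) * f r))"
    unfolding volterra_conv_def integral_open_interval_real[of 0 s]
    using s fs by (subst Henstock_Kurzweil_Integration.integral_diff)
      (auto intro!: integrable_on_Icc_iff_Ioo[THEN iffD1] kernel_mult_integrable)
  also have "\<dots> \<le> integral {0<..<s} (\<lambda>r. C * (k (s - r) - k (t - r)))"
  proof (rule Henstock_Kurzweil_Integration.integral_norm_bound_integral)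
    show "(\<lambda>r. k (s - r) * f r - k (t - r) * f r) integrable_on {0<..<s}"
      using s fs by (intro integrable_diff integrable_on_Icc_iff_Ioo[THEN iffD1] kernel_mult_integrable) auto
    show "(\<lambda>r. C * (k (s - r) - k (t - r))) integrable_on {0<..<s}"
      using kd by (intro integrable_on_mult_right integrable_on_Icc_iff_Ioo[THEN iffD1])
        (auto simp: has_integral_integrable)
    fix r assume r: "r \<in> {0<..<s}"
    have "norm (k (s - r) * f r - k (t - r) * f r) = (k (s - r) - k (t - r)) * \<bar>f r\<bar>"
      using r s kernel_antimono[of "s - r" "t - r"]
      by (simp add: left_diff_distrib[symmetric] abs_mult)
    also have "\<dots> \<le> (k (s - r) - k (t - r)) * C"
      using r s kernel_antimono[of "s - r" "t - r"] by (intro mult_left_mono bnd) auto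
    finally show "norm (k (s - r) * f r - k (t - r) * f r) \<le> C * (k (s - r) - k (t - r))"
      by (simp add: mult.commute)
  qed
  also have "\<dots> = C * (G s - (G t - G (t - s)))"
    using kd by (simp add: integral_open_interval_real[symmetric] integral_unique)
  also have "\<dots> \<le> C * G (t - s)"
    using primitive_mono[of s t] s \<open>C \<ge> 0\<close> by (intro mult_left_mono) auto
  finally have 1: "\<bar>volterra_conv \<kappa> f s - integral {0..s} (\<lambda>r. k (t - r) * f r)\<bar> \<le> C * G (t - s)" .
  have "norm (integral {s..t} (\<lambda>r. k (t - r) * f r)) \<le> integral {s..t} (\<lambda>r. C * k (t - r))"
  proof (rule Henstock_Kurzweil_Integration.integral_norm_bound_integral)
    show "(\<lambda>r. k (t - r) * f r) integrable_on {s..t}"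
      using ft by (intro kernel_mult_integrable) auto
    show "(\<lambda>r. C * k (t - r)) integrable_on {s..t}"
      using kt by (intro integrable_on_mult_right) (auto simp: has_integral_integrable)
    fix r assume r: "r \<in> {s..t}"
    have "norm (k (t - r) * f r) = k (t - r) * \<bar>f r\<bar>"
      using r kernel_ge_1[of "t - r"] by (simp add: abs_mult)
    also have "\<dots> \<le> k (t - r) * C"
      using r s kernel_ge_1[of "t - r"] by (intro mult_left_mono bnd) auto
    finally show "norm (k (t - r) * f r) \<le> C * k (t - r)"
      by (simp add: mult.commute)
  qed
  also have "\<dots> = C * G (t - s)"
    using kt by (simp add: integral_unique)
  finally have "\<bar>integral {s..t} (\<lambda>r. k (t - r) * f r)\<bar> \<le> C * G (t - s)" by simp
  with 1 show ?thesis
    using volterra_conv_split[OF f s] by linarith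
qed

lemma continuous_volterra_conv:
  assumes f: "continuous_on {0..} f"
  shows "continuous_on {0..} (volterra_conv \<kappa> f)"
proof -
  \<comment> \<open>On such an interval \<open>f\<close> is bounded, and the interval is relatively
    open in \<open>{0..}\<close>, so continuity carries over to the half-line.\<close>
  have "continuous_on {0..<b} (volterra_conv \<kappa> f)" for b
  proof (cases "b > 0")
    case True
    have f': "continuous_on {0..x} f" for x
      by (rule continuous_on_subset[OF f]) auto
    have "bounded (f ` {0..b})"
      by (intro compact_imp_bounded compact_continuous_image f') auto
    then obtain C where C: "\<And>x. x \<in> {0..b} \<Longrightarrow> \<bar>f x\<bar> \<le> C"
      unfolding bounded_iff by (metis imageI real_norm_def)
    show ?thesis
      unfolding continuous_on_def
    proof
      fix x assume x: "x \<in> {0..<b}"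
      have est: "\<bar>volterra_conv \<kappa> f y - volterra_conv \<kappa> f x\<bar> \<le> 2 * C * G \<bar>y - x\<bar>"
        if "y \<in> {0..<b}" for y
      proof (cases "x \<le> y")
        case True
        then show ?thesis
          using volterra_conv_modulus[OF f', of y C x] x that C by auto
      next
        case False
        then show ?thesis
          using volterra_conv_modulus[OF f', of x C y] x that C by (auto simp: abs_minus_commute)
      qed
      have "((\<lambda>y. 2 * C * G \<bar>y - x\<bar>) \<longlongrightarrow> 2 * C * G \<bar>x - x\<bar>) (at x within {0..<b})"
        using continuous_primitive[of UNIV]
        by (intro tendsto_intros continuous_on_tendsto_compose[OF continuous_primitive[of UNIV]]) auto
      then have "((\<lambda>y. 2 * C * G \<bar>y - x\<bar>) \<longlongrightarrow> 0) (at x within {0..<b})"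
        by simp
      then have "((\<lambda>y. volterra_conv \<kappa> f y - volterra_conv \<kappa> f x) \<longlongrightarrow> 0) (at x within {0..<b})"
        by (rule Lim_null_comparison[rotated]) (use est in \<open>auto simp: eventually_at_topological\<close>)
      then show "(volterra_conv \<kappa> f \<longlongrightarrow> volterra_conv \<kappa> f x) (at x within {0..<b})"
        by (simp add: LIM_zero_iff)
    qed
  qed auto
  then have "continuous (at x within {0..}) (volterra_conv \<kappa> f)" if "x \<ge> 0" for x
  proof -
    have "continuous (at x within {0..<x + 1}) (volterra_conv \<kappa> f)"
      using \<open>\<And>b. continuous_on {0..<b} (volterra_conv \<kappa> f)\<close>[of "x + 1"] that
      by (auto simp: continuous_on_eq_continuous_within)
    moreover have "at x within {0..<x + 1} = at x within {0..}"
      using that by (intro at_within_nhd[of _ "{..<x + 1}"]) auto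
    ultimately show ?thesis by (simp add: continuous_def)
  qed
  then show ?thesis
    by (simp add: continuous_on_eq_continuous_within)
qed

end

lemma has_bochner_integral_lborel_absolutely_integrable:
  fixes f :: "real \<Rightarrow> real"
  assumes "has_bochner_integral lborel (\<lambda>t. indicator S t * f t) I"
  shows "f absolutely_integrable_on S" "integral S f = I"
proof -
  have "(\<lambda>t. indicator S t * f t) \<in> borel_measurable lborel"
    using assms borel_measurable_integrable unfolding has_bochner_integral_iff by blast
  then show f: "f absolutely_integrable_on S"
    using assms integrable_completion[of "\<lambda>t. indicator S t * f t" lborel]
    unfolding set_integrable_def has_bochner_integral_iff by simp
  have "integral S f = (LINT t:S|lebesgue. f t)"
    by (rule set_lebesgue_integral_eq_integral(2)[OF f, symmetric])
  also have "\<dots> = I"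
    using assms \<open>_ \<in> borel_measurable lborel\<close>
    by (simp add: set_lebesgue_integral_def integral_completion has_bochner_integral_iff)
  finally show "integral S f = I" .
qed

text \<open>Absolute integrability refers to the completed measure, Fubini to \<open>lborel\<close>;
  Borel measurability of the cut-off integrand bridges the two.\<close>

lemma absolutely_integrable_has_bochner_integral_lborel:
  fixes f :: "real \<Rightarrow> real"
  assumes f: "f absolutely_integrable_on S"
    and meas: "(\<lambda>t. indicator S t * f t) \<in> borel_measurable borel"
  shows "has_bochner_integral lborel (\<lambda>t. indicator S t * f t) (integral S f)"
  using f meas set_lebesgue_integral_eq_integral(2)[OF f]
  by (simp add: set_integrable_def integrable_completion has_bochner_integral_iff
      set_lebesgue_integral_def integral_completion)

section \<open>From the transform of \<psi> to its sign, size and decay\<close>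

locale laplace_kernel = nonneg_kernel_param +
  fixes \<psi> :: "real \<Rightarrow> real"
  assumes psi_continuous: "continuous_on {0..} \<psi>"
    and psi_laplace: "has_laplace_transform \<psi> (\<lambda>s. 1 / (s + \<kappa> * sqrt s + 1))"
begin

abbreviation "J \<equiv> volterra_conv \<kappa> \<psi>"

lemma psi_continuous_on: "0 \<le> a \<Longrightarrow> continuous_on {a..b} \<psi>"
  by (rule continuous_on_subset[OF psi_continuous]) auto

lemma psi_integrable_on: "0 \<le> a \<Longrightarrow> \<psi> integrable_on {a..b}"
  by (intro integrable_continuous_interval psi_continuous_on)

text \<open>exp (-pt) factors as exp (-p(t - s)) exp (-ps), so the weighted k * \<psi> is a
  whole-line convolution of the weighted and cut-off factors \<open>F\<close> and
  \<open>H\<close>.\<close>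

lemma laplace_volterra_conv:
  assumes p: "p > 0"
  shows "has_bochner_integral lborel (\<lambda>t. indicator {0..} t * (exp (- (p * t)) * J t))
           ((1 / p + \<kappa> / sqrt p) * (1 / (p + \<kappa> * sqrt p + 1)))"
proof -
  define F where "F = (\<lambda>t. indicator {0..} t * (exp (- (p * t)) * k t))"
  define H where "H = (\<lambda>t. indicator {0..} t * (exp (- (p * t)) * \<psi> t))"
  have F: "has_bochner_integral lborel F (1 / p + \<kappa> / sqrt p)"
    unfolding F_def by (rule has_bochner_integral_volterra_kernel_laplace[OF p])
  have "continuous_on {0..} (\<lambda>t. exp (- (p * t)) * \<psi> t)"
    by (intro continuous_intros psi_continuous)
  then have "H \<in> borel_measurable borel"
    using borel_measurable_continuous_on_indicator[of "{0..}" "\<lambda>t. exp (- (p * t)) * \<psi> t"]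
    by (simp add: H_def)
  moreover have "(\<lambda>t. exp (- (p * t)) * \<psi> t) absolutely_integrable_on {0..}"
    and I: "integral {0..} (\<lambda>t. exp (- (p * t)) * \<psi> t) = 1 / (p + \<kappa> * sqrt p + 1)"
    using psi_laplace p unfolding has_laplace_transform_def by blast+
  ultimately have H: "has_bochner_integral lborel H (1 / (p + \<kappa> * sqrt p + 1))"
    unfolding H_def I[symmetric] by (intro absolutely_integrable_has_bochner_integral_lborel)
  have [measurable]: "F \<in> borel_measurable borel" "H \<in> borel_measurable borel"
    using F H by (auto simp: has_bochner_integral_iff borel_measurable_integrable)
  have eq: "(\<integral>s. F (t - s) * H s \<partial>lborel) = indicator {0..} t * (exp (- (p * t)) * J t)" for t
  proof (cases "t \<ge> 0")
    case True
    have i: "F (t - s) * H s = indicator {0..t} s * (exp (- (p * t)) * (k (t - s) * \<psi> s))" for s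
    proof -
      have "exp (- (p * (t - s))) * exp (- (p * s)) = exp (- (p * t))"
        by (simp add: exp_add[symmetric] algebra_simps)
      then show ?thesis
        by (auto simp: F_def H_def indicator_def)
    qed
    have "(\<lambda>s. exp (- (p * t)) * (k (t - s) * \<psi> s)) absolutely_integrable_on {0..t}"
      by (intro set_integrable_mult_right kernel_mult_absolutely_integrable psi_continuous_on) auto
    moreover have "(\<lambda>s. F (t - s) * H s) \<in> borel_measurable borel"
      by measurable
    ultimately have "has_bochner_integral lborel (\<lambda>s. F (t - s) * H s)
        (integral {0..t} (\<lambda>s. exp (- (p * t)) * (k (t - s) * \<psi> s)))"
      unfolding i by (rule absolutely_integrable_has_bochner_integral_lborel)
    then show ?thesis
      using True by (simp add: has_bochner_integral_iff volterra_conv_def)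
  next
    case False
    then have "F (t - s) * H s = 0" for s
      by (auto simp: F_def H_def indicator_def)
    then have "(\<lambda>s. F (t - s) * H s) = (\<lambda>_. 0)" by blast
    with False show ?thesis by (simp only: integral_zero) simp
  qed
  show ?thesis
    using convolution_integrable_lborel[of F H] F H
    by (simp add: has_bochner_integral_iff eq)
qed

text \<open>The identity 1 + 1/p + \<kappa> / sqrt p = (p + \<kappa> sqrt p + 1) / p shows that
  \<psi> + J has the transform 1/p of the constant 1. Continuity of \<open>J\<close> turns equality
  of transforms into equality at every point.\<close>

lemma volterra_equation:
  assumes "t \<ge> 0"
  shows "\<psi> t + J t = 1"
proof -
  have int: "(\<lambda>t. exp (- (p * t)) * (\<psi> t + J t - 1)) absolutely_integrable_on {0..}
      \<and> integral {0..} (\<lambda>t. exp (- (p * t)) * (\<psi> t + J t - 1)) = 0" if p: "p > 0" for p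
  proof -
    have a: "(\<lambda>t. exp (- (p * t)) * \<psi> t) absolutely_integrable_on {0..}"
        "integral {0..} (\<lambda>t. exp (- (p * t)) * \<psi> t) = 1 / (p + \<kappa> * sqrt p + 1)"
      using psi_laplace p by (auto simp: has_laplace_transform_def)
    note b = has_bochner_integral_lborel_absolutely_integrable[OF laplace_volterra_conv[OF p]]
    have c: "(\<lambda>t. exp (- (p * t))) absolutely_integrable_on {0..}"
        "integral {0..} (\<lambda>t. exp (- (p * t))) = 1 / p"
      using has_bochner_integral_lborel_absolutely_integrable[OF
          has_bochner_integral_volterra_kernel_laplace[OF p, of 0]]
      by (simp_all add: volterra_kernel_def)
    have eq: "(\<lambda>t. exp (- (p * t)) * (\<psi> t + J t - 1))
        = (\<lambda>t. exp (- (p * t)) * \<psi> t + exp (- (p * t)) * J t - exp (- (p * t)))"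
      by (simp add: algebra_simps)
    note ab = set_integral_add(1)[OF a(1) b(1)]
    have "p + \<kappa> * sqrt p + 1 > 0"
      using p kappa_nonneg by (simp add: add_nonneg_pos add_pos_nonneg)
    moreover have "\<kappa> / sqrt p = \<kappa> * sqrt p / p"
      using p by (simp add: field_simps)
    ultimately have "1 / (p + \<kappa> * sqrt p + 1) + (1 / p + \<kappa> / sqrt p) * (1 / (p + \<kappa> * sqrt p + 1)) - 1 / p = 0"
      using p by (simp add: divide_simps) (simp add: algebra_simps)
    then have "integral {0..} (\<lambda>t. exp (- (p * t)) * \<psi> t + exp (- (p * t)) * J t - exp (- (p * t))) = 0"
      using a b c ab
      by (simp add: Henstock_Kurzweil_Integration.integral_diff Henstock_Kurzweil_Integration.integral_add
          set_lebesgue_integral_eq_integral(1))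
    with set_integral_diff(1)[OF ab c(1)] show ?thesis
      unfolding eq by simp
  qed
  have "\<psi> t + J t - 1 = 0"
    by (rule laplace_transform_zero[OF _ _ _ assms])
       (use int in \<open>auto intro!: continuous_intros psi_continuous continuous_volterra_conv\<close>)
  then show ?thesis by simp
qed

text \<open>If \<open>\<psi>\<close> had a negative minimum \<open>- m\<close> over \<open>{0..t1}\<close>, attained at \<open>t\<close>, then \<open>\<chi> = \<psi> + m\<close>
  would satisfy \<open>\<chi> + k * \<chi> = 1 + m + m * G\<close> with an increasing right-hand side. Since the kernel
  decreases, this bounds \<open>\<chi>\<close> just before \<open>t\<close> by half its own maximum there, so \<open>\<chi>\<close> vanishes there,
  contradicting the strict growth of the right-hand side.\<close>

lemma psi_nonneg:
  assumes "t1 \<ge> 0"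
  shows "0 \<le> \<psi> t1"
proof (rule ccontr)
  assume neg: "\<not> 0 \<le> \<psi> t1"
  obtain t where t: "t \<in> {0..t1}" and min: "\<And>r. r \<in> {0..t1} \<Longrightarrow> \<psi> t \<le> \<psi> r"
    using continuous_attains_inf[of "{0..t1}" \<psi>] assms psi_continuous_on by auto
  define m where "m = - \<psi> t"
  have m: "m > 0"
    using min[of t1] assms neg by (auto simp: m_def)
  \<comment> \<open>Keeps the negative minimum away from 0, so that there is room for a window to
    its left.\<close>
  have "\<psi> 0 = 1"
    using volterra_equation[of 0] by (simp add: volterra_conv_def)
  then have "t > 0"
    using t m by (cases "t = 0") (auto simp: m_def)
  obtain d where d: "d > 0" "\<And>x. 0 \<le> x \<Longrightarrow> x \<le> d \<Longrightarrow> G x < 1 / 2"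
    using primitive_small[of "1 / 2"] by auto
  define s where "s = max 0 (t - d)"
  have s: "0 \<le> s" "s < t" "t - s \<le> d"
    using \<open>t > 0\<close> d(1) by (auto simp: s_def)
  let ?\<chi> = "\<lambda>r. \<psi> r + m"
  have chi: "continuous_on {a..b} ?\<chi>" if "0 \<le> a" for a b
    using that by (intro continuous_intros psi_continuous_on)
  have Jchi: "volterra_conv \<kappa> ?\<chi> r = 1 - \<psi> r + m * G r" if "0 \<le> r" for r
  proof -
    have "((\<lambda>u. k (r - u)) has_integral G r) {0..r}"
      using kernel_has_integral[of 0 r r] that by simp
    then have "((\<lambda>u. k (r - u) * \<psi> u + m * k (r - u)) has_integral J r + m * G r) {0..r}"
      unfolding volterra_conv_def
      by (intro has_integral_add has_integral_mult_right integrable_integral kernel_mult_integrable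
          psi_continuous_on) auto
    then have "((\<lambda>u. k (r - u) * ?\<chi> u) has_integral J r + m * G r) {0..r}"
      by (simp only: distrib_left mult.commute[of m])
    then have "volterra_conv \<kappa> ?\<chi> r = J r + m * G r"
      unfolding volterra_conv_def[of _ ?\<chi>] by (rule integral_unique)
    then show ?thesis
      using volterra_equation[OF that] by simp
  qed
  have nonneg: "0 \<le> ?\<chi> r" if "0 \<le> r" "r \<le> t" for r
    using min[of r] that t by (auto simp: m_def)
  obtain s' where s': "s' \<in> {s..t}" and max: "\<And>r. r \<in> {s..t} \<Longrightarrow> ?\<chi> r \<le> ?\<chi> s'"
    using continuous_attains_sup[of "{s..t}" ?\<chi>] s chi by (metis atLeastAtMost_iff compact_Icc empty_iff less_imp_le order_refl)
  \<comment> \<open>Difference of the equations for \<chi> at t, where \<chi> vanishes, and at q.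
    The part of the convolution over \<open>{0..q}\<close> only drops from q to t, so the window
    \<open>{q..t}\<close> must supply the whole increase. Used at the maximum point
    \<open>s'\<close> and at the left end \<open>s\<close>.\<close>
  have key: "?\<chi> q + m * (G t - G q) \<le> ?\<chi> s' * G (t - q)" if q: "s \<le> q" "q \<le> t" for q
  proof -
    have "integral {0..q} (\<lambda>r. k (t - r) * ?\<chi> r) \<le> volterra_conv \<kappa> ?\<chi> q"
      using s q nonneg by (intro integral_kernel_shift_le chi) auto
    then have "volterra_conv \<kappa> ?\<chi> t - volterra_conv \<kappa> ?\<chi> q \<le> integral {q..t} (\<lambda>r. k (t - r) * ?\<chi> r)"
      using volterra_conv_split[of t ?\<chi> q] chi s q by auto
    also have "\<dots> \<le> integral {q..t} (\<lambda>r. ?\<chi> s' * k (t - r))"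
    proof (rule integral_le)
      show "(\<lambda>r. k (t - r) * ?\<chi> r) integrable_on {q..t}"
        using s q by (intro kernel_mult_integrable chi) auto
      show "(\<lambda>r. ?\<chi> s' * k (t - r)) integrable_on {q..t}"
        using s q by (intro integrable_on_mult_right has_integral_integrable[OF kernel_has_integral]) auto
      fix r assume r: "r \<in> {q..t}"
      then have "?\<chi> r \<le> ?\<chi> s'"
        using q by (intro max) auto
      with r show "k (t - r) * ?\<chi> r \<le> ?\<chi> s' * k (t - r)"
        using mult_left_mono[OF _ kernel_nonneg[of "t - r"], of "?\<chi> r" "?\<chi> s'"] by (simp add: mult.commute)
    qed
    also have "\<dots> = ?\<chi> s' * G (t - q)"
      using kernel_has_integral[of q t t] q by (simp add: integral_unique)
    finally show ?thesis
      using Jchi[of t] Jchi[of q] s q by (simp add: m_def algebra_simps)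
  qed
  have "?\<chi> s' \<le> ?\<chi> s' * G (t - s')"
    using key[of s'] s' s m primitive_mono[of s' t]
    by (smt (verit) atLeastAtMost_iff zero_le_mult_iff)
  also have "\<dots> \<le> ?\<chi> s' * (1 / 2)"
    using d(2)[of "t - s'"] s' s by (intro mult_left_mono nonneg) (auto intro: less_imp_le)
  finally have "?\<chi> s' \<le> 0" by simp
  moreover have "0 \<le> G (t - s)"
    using primitive_mono[of 0 "t - s"] s by simp
  ultimately have "?\<chi> s + m * (G t - G s) \<le> 0"
    using key[of s] s by (smt (verit) mult_nonpos_nonneg)
  moreover have "m * (G t - G s) > 0"
    using m primitive_strict_mono[of s t] s by simp
  ultimately show False
    using nonneg[of s] s by simp
qed

lemma psi_plus_integral_le_1:
  assumes "t \<ge> 0"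
  shows "\<psi> t + integral {0..t} \<psi> \<le> 1"
proof -
  have "integral {0..t} \<psi> \<le> J t"
    unfolding volterra_conv_def
    using mult_right_mono[OF kernel_ge_1 psi_nonneg]
    by (intro integral_le kernel_mult_integrable psi_integrable_on psi_continuous_on) auto
  with volterra_equation[OF assms] show ?thesis by simp
qed

lemma integral_psi_nonneg: "0 \<le> a \<Longrightarrow> 0 \<le> integral {a..b} \<psi>"
  by (intro Henstock_Kurzweil_Integration.integral_nonneg psi_integrable_on psi_nonneg) auto

lemma psi_le_1: "0 \<le> t \<Longrightarrow> \<psi> t \<le> 1"
  using psi_plus_integral_le_1[of t] integral_psi_nonneg[of 0 t] by simp

lemma integral_psi_le_1: "0 \<le> t \<Longrightarrow> integral {0..t} \<psi> \<le> 1"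
  using psi_plus_integral_le_1[of t] psi_nonneg[of t] by simp

lemma integral_psi_combine:
  "0 \<le> s \<Longrightarrow> s \<le> t \<Longrightarrow> integral {0..t} \<psi> = integral {0..s} \<psi> + integral {s..t} \<psi>"
  by (intro Henstock_Kurzweil_Integration.integral_combine[symmetric] psi_integrable_on) auto

text \<open>The integral from 0 increases and stays below 1; once it is within \<open>e\<close> of
  its supremum, every later window, however long, carries less than \<open>e\<close>.\<close>

lemma integral_psi_tail_small:
  assumes "e > 0"
  obtains T where "T \<ge> 0" "\<And>s t. T \<le> s \<Longrightarrow> s \<le> t \<Longrightarrow> integral {s..t} \<psi> < e"
proof -
  let ?S = "(\<lambda>t. integral {0..t} \<psi>) ` {0..}"
  have bdd: "bdd_above ?S"
    by (rule bdd_aboveI2[of _ _ 1]) (simp add: integral_psi_le_1)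
  obtain T where T: "T \<ge> 0" "Sup ?S - e < integral {0..T} \<psi>"
    using less_cSupD[of ?S "Sup ?S - e"] \<open>e > 0\<close> by auto
  show ?thesis
  proof (rule that[OF T(1)])
    fix s t assume "T \<le> s" "s \<le> t"
    then have "integral {0..t} \<psi> \<le> Sup ?S"
      using T(1) by (intro cSup_upper bdd) auto
    moreover have "integral {0..t} \<psi> = integral {0..s} \<psi> + integral {s..t} \<psi>"
      "integral {0..s} \<psi> = integral {0..T} \<psi> + integral {T..s} \<psi>"
      using \<open>T \<le> s\<close> \<open>s \<le> t\<close> T(1) by (intro integral_psi_combine; simp)+
    ultimately show "integral {s..t} \<psi> < e"
      using T integral_psi_nonneg[of T s] by simp
  qed
qed

text \<open>By the Volterra equation \<psi> varies exactly as \<open>J\<close> does, up to sign, and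
  \<psi> \<le> 1 allows the constant C = 1.\<close>

lemma psi_modulus: "0 \<le> s \<Longrightarrow> s \<le> t \<Longrightarrow> \<bar>\<psi> t - \<psi> s\<bar> \<le> 2 * G (t - s)"
  using volterra_conv_modulus[of t \<psi> 1 s] volterra_equation[of t] volterra_equation[of s]
  by (simp add: psi_continuous_on psi_nonneg psi_le_1)

text \<open>Barbalat's argument: \<open>\<psi>\<close> is uniformly continuous and integrable.\<close>

lemma psi_tendsto_0: "(\<psi> \<longlongrightarrow> 0) at_top"
proof (rule tendstoI)
  fix e :: real assume "e > 0"
  \<comment> \<open>With e/4 the modulus 2 G stays below e/2 on a window of length \<open>d\<close>:
    a value of at least e leaves \<psi> \<ge> e/2 there, hence a mass of at least d e/2.\<close>
  then obtain d where d: "d > 0" "\<And>x. 0 \<le> x \<Longrightarrow> x \<le> d \<Longrightarrow> G x < e / 4"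
    using primitive_small[of "e / 4"] by auto
  obtain T where T: "T \<ge> 0" "\<And>s t. T \<le> s \<Longrightarrow> s \<le> t \<Longrightarrow> integral {s..t} \<psi> < d * (e / 2)"
    using integral_psi_tail_small[of "d * (e / 2)"] \<open>e > 0\<close> d(1) by auto
  have "\<psi> t < e" if "t \<ge> T" for t
  proof (rule ccontr)
    assume "\<not> \<psi> t < e"
    have "integral {t..t + d} (\<lambda>_. e / 2) \<le> integral {t..t + d} \<psi>"
    proof (rule integral_le)
      show "\<psi> integrable_on {t..t + d}"
        using that T by (intro psi_integrable_on) auto
      fix r assume "r \<in> {t..t + d}"
      then show "e / 2 \<le> \<psi> r"
        using psi_modulus[of t r] d(2)[of "r - t"] that T(1) \<open>\<not> \<psi> t < e\<close> by auto
    qed auto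
    then show False
      using T(2)[of t "t + d"] that d(1) by simp
  qed
  then show "eventually (\<lambda>t. dist (\<psi> t) 0 < e) at_top"
    unfolding eventually_at_top_linorder using T(1) psi_nonneg
    by (intro exI[of _ T]) auto
qed

end

section \<open>Convolution powers of \<open>\<psi>\<close>\<close>

lemma conv_integrable:
  fixes h f :: "real \<Rightarrow> real"
  assumes "continuous_on {0..} h" "continuous_on {0..} f"
  shows "(\<lambda>s. h (t - s) * f s) integrable_on {0..t}"
  by (intro integrable_continuous_interval continuous_intros continuous_on_compose2[OF assms(1)]
      continuous_on_subset[OF assms(2)]) auto

text \<open>Reflection s to t - s. Needed because the mild formulation puts \<psi> in the first
  factor, the convolution powers in the second.\<close>

lemma conv_commute:
  fixes h f :: "real \<Rightarrow> real"
  assumes "continuous_on {0..} h" "continuous_on {0..} f"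
  shows "conv h f t = conv f h t"
proof -
  have "((\<lambda>s. h (t - s) * f s) has_integral conv h f t) (cbox 0 t)"
    using integrable_integral[OF conv_integrable[OF assms]] by (simp add: conv_def)
  from has_integral_affinity[OF this, of "-1" t]
  have "((\<lambda>s. f (t - s) * h s) has_integral conv h f t) ((\<lambda>s. t - s) ` {0..t})"
    by (simp add: mult.commute)
  then show ?thesis
    by (simp add: conv_def integral_unique)
qed

text \<open>The substitution s = t v moves the variable endpoint into the integrand, leaving a
  parameter integral over a fixed interval.\<close>

lemma continuous_conv:
  assumes h: "continuous_on {0..} h" and f: "continuous_on {0..} f"
  shows "continuous_on {0..} (conv h f)"
proof -
  have eq: "conv h f t = t * integral (cbox 0 1) (\<lambda>v. h (t - t * v) * f (t * v))" if "t \<in> {0..}" for t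
  proof (cases "t > 0")
    case True
    have "((\<lambda>s. h (t - s) * f s) has_integral conv h f t) (cbox 0 t)"
      using integrable_integral[OF conv_integrable[OF assms]] by (simp add: conv_def)
    from has_integral_affinity'[OF this True, of 0] True show ?thesis
      by (simp add: integral_unique field_simps)
  qed (use that in \<open>auto simp: conv_def\<close>)
  have "continuous_on ({0..} \<times> cbox 0 1) (\<lambda>(t, v). h (t - t * v) * f (t * v))"
    unfolding case_prod_unfold
    by (intro continuous_intros continuous_on_compose2[OF h] continuous_on_compose2[OF f])
       (auto simp: mult_left_le)
  then have "continuous_on {0..} (\<lambda>t. t * integral (cbox 0 1) (\<lambda>v. h (t - t * v) * f (t * v)))"
    by (intro continuous_intros integral_continuous_on_param)
  then show ?thesis
    using eq by (subst continuous_on_cong[OF refl]) auto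
qed

lemma conv_power_Suc_0: "conv_power f (Suc 0) = f"
  by (simp add: conv_power_def)

lemma conv_power_Suc_Suc: "conv_power f (Suc (Suc j)) = conv (conv_power f (Suc j)) f"
  by (simp add: conv_power_def)

context laplace_kernel
begin

lemma conv_psi_le:
  assumes "continuous_on {0..} h" "0 \<le> t" "\<And>s. s \<in> {0..t} \<Longrightarrow> h s \<le> C"
  shows "conv h \<psi> t \<le> C * integral {0..t} \<psi>"
proof -
  have "conv h \<psi> t \<le> integral {0..t} (\<lambda>s. C * \<psi> s)"
    unfolding conv_def using assms
    by (intro integral_le conv_integrable integrable_on_mult_right psi_integrable_on psi_continuous
        mult_right_mono psi_nonneg) auto
  then show ?thesis by simp
qed

lemma conv_psi_nonneg:
  assumes "continuous_on {0..} h" "\<And>s. s \<in> {0..t} \<Longrightarrow> 0 \<le> h s"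
  shows "0 \<le> conv h \<psi> t"
  unfolding conv_def using assms
  by (intro Henstock_Kurzweil_Integration.integral_nonneg conv_integrable psi_continuous
      mult_nonneg_nonneg psi_nonneg) auto

text \<open>Cut at t - T1. Before the cut the argument of \<open>h\<close> is at least T1, so
  \<open>h\<close> is small against total mass at most 1; after it \<open>h\<close> is at most 1
  against a small tail of \<psi>.\<close>

lemma conv_psi_tendsto_0:
  assumes h: "continuous_on {0..} h" "\<And>t. 0 \<le> t \<Longrightarrow> 0 \<le> h t" "\<And>t. 0 \<le> t \<Longrightarrow> h t \<le> 1"
    and lim: "(h \<longlongrightarrow> 0) at_top"
  shows "(conv h \<psi> \<longlongrightarrow> 0) at_top"
proof (rule tendstoI)
  fix e :: real assume e: "e > 0"
  have "eventually (\<lambda>t. dist (h t) 0 < e / 2) at_top"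
    using lim e by (intro tendstoD) auto
  then obtain T0 where T0: "\<And>t. t \<ge> T0 \<Longrightarrow> \<bar>h t\<bar> < e / 2"
    by (auto simp: eventually_at_top_linorder)
  define T1 where "T1 = max 0 T0"
  have T1: "T1 \<ge> 0" "\<And>t. t \<ge> T1 \<Longrightarrow> h t \<le> e / 2"
    using T0 by (force simp: T1_def abs_less_iff)+
  obtain T2 where T2: "T2 \<ge> 0" "\<And>s t. T2 \<le> s \<Longrightarrow> s \<le> t \<Longrightarrow> integral {s..t} \<psi> < e / 2"
    using integral_psi_tail_small[of "e / 2"] e by auto
  have "\<bar>conv h \<psi> t\<bar> < e" if t: "t \<ge> T1 + T2" for t
  proof -
    let ?r = "t - T1"
    have hc: "(\<lambda>s. h (t - s) * \<psi> s) integrable_on {a..b}" if "0 \<le> a" "b \<le> t" for a b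
      using integrable_on_subinterval[OF conv_integrable[OF h(1) psi_continuous, of t]] that by auto
    have "conv h \<psi> t = integral {0..?r} (\<lambda>s. h (t - s) * \<psi> s) + integral {?r..t} (\<lambda>s. h (t - s) * \<psi> s)"
      unfolding conv_def using t T1(1) T2(1) hc
      by (intro Henstock_Kurzweil_Integration.integral_combine[symmetric]) auto
    also have "integral {0..?r} (\<lambda>s. h (t - s) * \<psi> s) \<le> integral {0..?r} (\<lambda>s. e / 2 * \<psi> s)"
    proof (rule integral_le)
      fix s assume "s \<in> {0..?r}"
      then show "h (t - s) * \<psi> s \<le> e / 2 * \<psi> s"
        by (intro mult_right_mono T1(2) psi_nonneg) auto
    qed (use T1(1) in \<open>auto intro!: hc integrable_on_mult_right psi_integrable_on\<close>)
    also have "\<dots> \<le> e / 2"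
      using integral_psi_le_1[of ?r] t T2(1) e by simp
    also have "integral {?r..t} (\<lambda>s. h (t - s) * \<psi> s) \<le> integral {?r..t} \<psi>"
    proof (rule integral_le)
      fix s assume "s \<in> {?r..t}"
      then show "h (t - s) * \<psi> s \<le> \<psi> s"
        using t T2(1) by (intro mult_left_le_one_le psi_nonneg h) auto
    qed (use t T2(1) in \<open>auto intro!: hc psi_integrable_on\<close>)
    also have "integral {?r..t} \<psi> < e / 2"
      using t T1(1) by (intro T2(2)) auto
    finally have "conv h \<psi> t < e" by simp
    moreover have "0 \<le> conv h \<psi> t"
      using h by (intro conv_psi_nonneg) auto
    ultimately show ?thesis by simp
  qed
  then show "eventually (\<lambda>t. dist (conv h \<psi> t) 0 < e) at_top"
    by (auto simp: eventually_at_top_linorder)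
qed

text \<open>A single induction proves all four, because decay of the next power uses continuity and
  bounds of the previous one.\<close>

lemma conv_power_psi:
  shows continuous_conv_power: "continuous_on {0..} (conv_power \<psi> (Suc j))"
    and conv_power_nonneg: "0 \<le> t \<Longrightarrow> 0 \<le> conv_power \<psi> (Suc j) t"
    and conv_power_le_1: "0 \<le> t \<Longrightarrow> conv_power \<psi> (Suc j) t \<le> 1"
    and conv_power_tendsto_0: "(conv_power \<psi> (Suc j) \<longlongrightarrow> 0) at_top"
proof -
  have "continuous_on {0..} (conv_power \<psi> (Suc j)) \<and>
      (\<forall>t\<ge>0. 0 \<le> conv_power \<psi> (Suc j) t \<and> conv_power \<psi> (Suc j) t \<le> 1) \<and>
      (conv_power \<psi> (Suc j) \<longlongrightarrow> 0) at_top"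
  proof (induction j)
    case 0
    show ?case
      by (simp add: conv_power_Suc_0 psi_continuous psi_nonneg psi_le_1 psi_tendsto_0)
  next
    case (Suc j)
    let ?h = "conv_power \<psi> (Suc j)"
    have h: "continuous_on {0..} ?h" "\<And>t. 0 \<le> t \<Longrightarrow> 0 \<le> ?h t" "\<And>t. 0 \<le> t \<Longrightarrow> ?h t \<le> 1"
        "(?h \<longlongrightarrow> 0) at_top"
      using Suc by blast+
    have "conv ?h \<psi> t \<le> 1" if "t \<ge> 0" for t
      using conv_psi_le[OF h(1) that, of 1] h(3) integral_psi_le_1[OF that] by simp
    moreover have "0 \<le> conv ?h \<psi> t" for t
      using h(2) by (intro conv_psi_nonneg h(1)) simp
    ultimately show ?case
      unfolding conv_power_Suc_Suc
      using continuous_conv[OF h(1) psi_continuous] conv_psi_tendsto_0[OF h] by blast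
  qed
  then show "continuous_on {0..} (conv_power \<psi> (Suc j))"
    "0 \<le> t \<Longrightarrow> 0 \<le> conv_power \<psi> (Suc j) t" "0 \<le> t \<Longrightarrow> conv_power \<psi> (Suc j) t \<le> 1"
    "(conv_power \<psi> (Suc j) \<longlongrightarrow> 0) at_top"
    by auto
qed

section \<open>The resolvent series of \<psi>\<close>

definition resolvent_sum :: "real \<Rightarrow> nat \<Rightarrow> real \<Rightarrow> real" where
  "resolvent_sum a N t = (\<Sum>j<N. a ^ j * conv_power \<psi> (Suc j) t)"

text \<open>The Neumann series of r = \<psi> + a (r * \<psi>). Indices start at 0, so
  \<open>a ^ j\<close> goes with the (j+1)-fold convolution.\<close>

definition resolvent :: "real \<Rightarrow> real \<Rightarrow> real" where
  "resolvent a t = (\<Sum>j. a ^ j * conv_power \<psi> (Suc j) t)"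

lemma continuous_resolvent_sum: "continuous_on {0..} (resolvent_sum a N)"
  unfolding resolvent_sum_def by (intro continuous_intros continuous_conv_power)

lemma resolvent_term_le:
  assumes "0 \<le> a" "0 \<le> t"
  shows "norm (a ^ j * conv_power \<psi> (Suc j) t) \<le> a ^ j"
  using assms conv_power_nonneg[of t j] conv_power_le_1[of t j] by (simp add: abs_mult mult_left_le)

lemma uniform_limit_resolvent_sum:
  assumes "0 \<le> a" "a < 1"
  shows "uniform_limit {0..} (resolvent_sum a) (resolvent a) sequentially"
  unfolding resolvent_def[abs_def] resolvent_sum_def[abs_def]
  by (rule Weierstrass_m_test[of _ _ "\<lambda>j. a ^ j"])
     (use assms in \<open>auto intro!: resolvent_term_le[simplified] summable_geometric\<close>)

lemma resolvent_sum_tendsto: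
  assumes "0 \<le> a" "a < 1" "0 \<le> t"
  shows "(\<lambda>N. resolvent_sum a N t) \<longlonglongrightarrow> resolvent a t"
  using tendsto_uniform_limitI[OF uniform_limit_resolvent_sum[OF assms(1,2)]] assms(3) by simp

lemma resolvent_bounds:
  assumes "0 \<le> a" "a < 1" "0 \<le> t"
  shows "0 \<le> resolvent a t" "resolvent a t \<le> 1 / (1 - a)"
proof -
  have s: "summable (\<lambda>j. a ^ j * conv_power \<psi> (Suc j) t)"
    by (rule summable_comparison_test'[OF summable_geometric[of a]])
       (use assms resolvent_term_le in auto)
  show "0 \<le> resolvent a t"
    unfolding resolvent_def using assms by (intro suminf_nonneg s) (auto simp: conv_power_nonneg)
  have "resolvent a t \<le> (\<Sum>j. a ^ j)"
    unfolding resolvent_def using assms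
    by (intro suminf_le s summable_geometric) (auto simp: conv_power_le_1 mult_left_le)
  then show "resolvent a t \<le> 1 / (1 - a)"
    using assms by (simp add: suminf_geometric)
qed

text \<open>Finite partial sums decay term by term, and convergence uniform on the half-line passes
  this on to the limit.\<close>

lemma resolvent_tendsto_0:
  assumes "0 \<le> a" "a < 1"
  shows "(resolvent a \<longlongrightarrow> 0) at_top"
proof (rule tendstoI)
  fix e :: real assume e: "e > 0"
  have "eventually (\<lambda>N. \<forall>t\<in>{0..}. dist (resolvent_sum a N t) (resolvent a t) < e / 2) sequentially"
    using uniform_limitD[OF uniform_limit_resolvent_sum[OF assms], of "e / 2"] e by simp
  then obtain N where N: "\<And>t. t \<ge> 0 \<Longrightarrow> dist (resolvent_sum a N t) (resolvent a t) < e / 2"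
    by (auto simp: eventually_sequentially)
  have "((\<lambda>t. \<Sum>j<N. a ^ j * conv_power \<psi> (Suc j) t) \<longlongrightarrow> (\<Sum>j<N. a ^ j * 0)) at_top"
    by (intro tendsto_intros conv_power_tendsto_0)
  then have "(resolvent_sum a N \<longlongrightarrow> 0) at_top"
    by (simp add: resolvent_sum_def[abs_def])
  then have "eventually (\<lambda>t. dist (resolvent_sum a N t) 0 < e / 2) at_top"
    using e by (intro tendstoD) auto
  then show "eventually (\<lambda>t. dist (resolvent a t) 0 < e) at_top"
    using eventually_ge_at_top[of 0]
  proof eventually_elim
    case (elim t)
    with N[of t] show ?case unfolding dist_real_def by linarith
  qed
qed

text \<open>Convolution with \<psi> raises each power by one; multiplying by \<open>a\<close> and
  adding \<psi> produces the next partial sum.\<close>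

lemma conv_resolvent_sum:
  assumes "0 \<le> t"
  shows "((\<lambda>s. resolvent_sum a N (t - s) * \<psi> s) has_integral
           (\<Sum>j<N. a ^ j * conv_power \<psi> (Suc (Suc j)) t)) {0..t}"
proof -
  have "((\<lambda>s. \<Sum>j<N. a ^ j * (conv_power \<psi> (Suc j) (t - s) * \<psi> s)) has_integral
      (\<Sum>j<N. a ^ j * conv_power \<psi> (Suc (Suc j)) t)) {0..t}"
    unfolding conv_power_Suc_Suc conv_def
    by (intro has_integral_sum has_integral_mult_right integrable_integral conv_integrable
        continuous_conv_power psi_continuous) auto
  then show ?thesis
    by (simp add: resolvent_sum_def sum_distrib_right mult.assoc)
qed

lemma continuous_integral_psi: "continuous_on {0..} (\<lambda>t. integral {0..t} \<psi>)"
proof -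
  have "conv (\<lambda>_. 1) \<psi> = (\<lambda>t. integral {0..t} \<psi>)"
    by (simp add: conv_def)
  then show ?thesis
    using continuous_conv[of "\<lambda>_. 1" \<psi>] psi_continuous by simp
qed

text \<open>Each bound is itself a continuous majorant of \<open>v\<close>, so it can be fed back
  into \<open>renewal\<close>. This lengthens the partial sum by one term, reproduces the source
  terms and gains a factor \<epsilon> L_M on the crude bound \<open>C\<close>.\<close>

lemma renewal_iterate:
  fixes v :: "real \<Rightarrow> real"
  assumes eps: "0 \<le> \<epsilon>" and LM: "0 \<le> L_M" and LB: "0 \<le> L_B" and W: "0 \<le> W"
    and a: "\<epsilon> * L_M < 1"
    and crude: "\<And>t. t \<in> {0..T} \<Longrightarrow> v t \<le> C" and C: "0 \<le> C"
    and renewal: "\<And>q t. continuous_on {0..} q \<Longrightarrow> t \<in> {0..T} \<Longrightarrow> (\<And>s. s \<in> {0..t} \<Longrightarrow> v s \<le> q s) \<Longrightarrow>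
        v t \<le> W * \<psi> t + \<epsilon> * (L_M * conv q \<psi> t + L_B * integral {0..t} \<psi>)"
    and t: "t \<in> {0..T}"
  shows "v t \<le> W * resolvent_sum (\<epsilon> * L_M) N t + \<epsilon> * L_B * integral {0..t} \<psi>
       + \<epsilon>\<^sup>2 * L_M * L_B / (1 - \<epsilon> * L_M) + (\<epsilon> * L_M) ^ N * C"
  using t
proof (induction N arbitrary: t)
  case 0
  have "0 \<le> \<epsilon> * L_B * integral {0..t} \<psi>" "0 \<le> \<epsilon>\<^sup>2 * L_M * L_B / (1 - \<epsilon> * L_M)"
    using eps LM LB a integral_psi_nonneg[of 0 t] by auto
  with crude[OF 0] show ?case
    by (simp add: resolvent_sum_def)
next
  case (Suc N)
  define a where "a = \<epsilon> * L_M"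
  define c where "c = \<epsilon>\<^sup>2 * L_M * L_B / (1 - \<epsilon> * L_M)"
  have a01: "0 \<le> a" "a < 1"
    using eps LM \<open>\<epsilon> * L_M < 1\<close> by (auto simp: a_def)
  \<comment> \<open>\<open>c\<close> is the fixed point of x to a (\<epsilon> L_B + x), the sum of
    the geometric terms a^j \<epsilon> L_B over j \<ge> 1.\<close>
  have c: "0 \<le> c" "a * (\<epsilon> * L_B + c) = c"
    using a01 eps LM LB by (auto simp: c_def a_def field_simps power2_eq_square)
  define q where "q = (\<lambda>s. W * resolvent_sum a N s + (\<epsilon> * L_B * integral {0..s} \<psi> + c + a ^ N * C))"
  have t: "0 \<le> t" using Suc.prems by simp
  have "continuous_on {0..} q"
    unfolding q_def by (intro continuous_intros continuous_resolvent_sum continuous_integral_psi)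
  moreover have "v s \<le> q s" if "s \<in> {0..t}" for s
    using Suc.IH[of s] that Suc.prems by (simp add: q_def a_def c_def)
  ultimately have 1: "v t \<le> W * \<psi> t + \<epsilon> * (L_M * conv q \<psi> t + L_B * integral {0..t} \<psi>)"
    using Suc.prems by (intro renewal)
  have "conv q \<psi> t = W * (\<Sum>j<N. a ^ j * conv_power \<psi> (Suc (Suc j)) t)
      + conv (\<lambda>s. \<epsilon> * L_B * integral {0..s} \<psi> + c + a ^ N * C) \<psi> t"
  proof -
    have "((\<lambda>s. W * (resolvent_sum a N (t - s) * \<psi> s)
          + (\<epsilon> * L_B * integral {0..t - s} \<psi> + c + a ^ N * C) * \<psi> s) has_integral
        (W * (\<Sum>j<N. a ^ j * conv_power \<psi> (Suc (Suc j)) t)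
          + conv (\<lambda>s. \<epsilon> * L_B * integral {0..s} \<psi> + c + a ^ N * C) \<psi> t)) {0..t}"
      unfolding conv_def[of "\<lambda>s. \<epsilon> * L_B * integral {0..s} \<psi> + c + a ^ N * C"]
      by (intro has_integral_add has_integral_mult_right conv_resolvent_sum integrable_integral t
          conv_integrable[of "\<lambda>s. \<epsilon> * L_B * integral {0..s} \<psi> + c + a ^ N * C"]
          continuous_intros continuous_integral_psi psi_continuous)
    then show ?thesis
      unfolding conv_def[of q] by (intro integral_unique) (simp add: q_def distrib_right mult.assoc)
  qed
  \<comment> \<open>The integral of \<psi> inside the majorant is coarsened to 1, so it survives
    only in the source term of the outermost step; that term becomes \<epsilon> L_B (1 -
    \<phi>).\<close>
  also have "conv (\<lambda>s. \<epsilon> * L_B * integral {0..s} \<psi> + c + a ^ N * C) \<psi> t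
      \<le> (\<epsilon> * L_B + c + a ^ N * C) * integral {0..t} \<psi>"
    using eps LB mult_left_le[of _ "\<epsilon> * L_B"]
    by (intro conv_psi_le t continuous_intros continuous_integral_psi add_mono order_refl)
       (auto simp: integral_psi_le_1)
  also have "\<dots> \<le> \<epsilon> * L_B + c + a ^ N * C"
    using eps LB c(1) a01(1) C integral_psi_le_1[OF t] by (intro mult_left_le) auto
  finally have "a * conv q \<psi> t
      \<le> a * (W * (\<Sum>j<N. a ^ j * conv_power \<psi> (Suc (Suc j)) t) + (\<epsilon> * L_B + c + a ^ N * C))"
    using a01(1) by (intro mult_left_mono) auto
  also have "\<dots> = W * (a * (\<Sum>j<N. a ^ j * conv_power \<psi> (Suc (Suc j)) t)) + a * (\<epsilon> * L_B + c) + a ^ Suc N * C"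
    by (simp add: algebra_simps)
  also have "a * (\<epsilon> * L_B + c) = c" by (rule c(2))
  finally have 2: "a * conv q \<psi> t
      \<le> W * (a * (\<Sum>j<N. a ^ j * conv_power \<psi> (Suc (Suc j)) t)) + c + a ^ Suc N * C" .
  have "resolvent_sum a (Suc N) t = \<psi> t + a * (\<Sum>j<N. a ^ j * conv_power \<psi> (Suc (Suc j)) t)"
    by (simp add: resolvent_sum_def sum.lessThan_Suc_shift conv_power_Suc_0 sum_distrib_left mult.assoc
        del: sum.lessThan_Suc)
  then have 3: "W * resolvent_sum a (Suc N) t = W * \<psi> t + W * (a * (\<Sum>j<N. a ^ j * conv_power \<psi> (Suc (Suc j)) t))"
    by (simp add: distrib_left)
  have "v t \<le> W * \<psi> t + a * conv q \<psi> t + \<epsilon> * L_B * integral {0..t} \<psi>"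
    using 1 by (simp add: a_def distrib_left mult.assoc)
  with 2 3 show ?case
    unfolding c_def[symmetric] unfolding a_def[symmetric] by linarith
qed

lemma renewal_bound:
  fixes v :: "real \<Rightarrow> real"
  assumes "0 \<le> \<epsilon>" "0 \<le> L_M" "0 \<le> L_B" "0 \<le> W" "\<epsilon> * L_M < 1"
    and "\<And>t. t \<in> {0..T} \<Longrightarrow> v t \<le> C"
    and "\<And>q t. continuous_on {0..} q \<Longrightarrow> t \<in> {0..T} \<Longrightarrow> (\<And>s. s \<in> {0..t} \<Longrightarrow> v s \<le> q s) \<Longrightarrow>
        v t \<le> W * \<psi> t + \<epsilon> * (L_M * conv q \<psi> t + L_B * integral {0..t} \<psi>)"
    and t: "t \<in> {0..T}"
  shows "v t \<le> W * resolvent (\<epsilon> * L_M) t + \<epsilon> * L_B * integral {0..t} \<psi>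
       + \<epsilon>\<^sup>2 * L_M * L_B / (1 - \<epsilon> * L_M)"
proof -
  \<comment> \<open>The iteration asks for a nonnegative crude bound.\<close>
  have C: "v s \<le> max 0 C" if "s \<in> {0..T}" for s
    using assms(6)[OF that] by simp
  have a: "0 \<le> \<epsilon> * L_M" using assms by simp
  have "(\<lambda>N. W * resolvent_sum (\<epsilon> * L_M) N t + \<epsilon> * L_B * integral {0..t} \<psi>
       + \<epsilon>\<^sup>2 * L_M * L_B / (1 - \<epsilon> * L_M) + (\<epsilon> * L_M) ^ N * max 0 C)
     \<longlonglongrightarrow> W * resolvent (\<epsilon> * L_M) t + \<epsilon> * L_B * integral {0..t} \<psi>
       + \<epsilon>\<^sup>2 * L_M * L_B / (1 - \<epsilon> * L_M) + 0 * max 0 C"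
    using a assms(5) t by (intro tendsto_intros resolvent_sum_tendsto LIMSEQ_power_zero) auto
  then have "v t \<le> W * resolvent (\<epsilon> * L_M) t + \<epsilon> * L_B * integral {0..t} \<psi>
       + \<epsilon>\<^sup>2 * L_M * L_B / (1 - \<epsilon> * L_M) + 0 * max 0 C"
  proof (rule LIMSEQ_le_const, intro exI allI impI)
    fix N :: nat
    show "v t \<le> W * resolvent_sum (\<epsilon> * L_M) N t + \<epsilon> * L_B * integral {0..t} \<psi>
       + \<epsilon>\<^sup>2 * L_M * L_B / (1 - \<epsilon> * L_M) + (\<epsilon> * L_M) ^ N * max 0 C"
      by (rule renewal_iterate[OF assms(1-5) C _ assms(7) t]) auto
  qed
  then show ?thesis by simp
qed

end

section \<open>Mild solutions\<close>

lemma bounded_fieldE: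
  assumes "bounded_field D f"
  obtains K where "0 \<le> K" "\<And>x t. x \<in> D \<Longrightarrow> 0 \<le> t \<Longrightarrow> norm (f x t) \<le> K"
proof -
  obtain K where K: "\<And>z. z \<in> (\<lambda>(x, t). f x t) ` (D \<times> {0..}) \<Longrightarrow> norm z \<le> K"
    using assms unfolding bounded_field_def bounded_iff by blast
  show ?thesis
  proof (rule that[of "max 0 K"])
    fix x t assume "x \<in> D" "0 \<le> (t::real)"
    then have "f x t \<in> (\<lambda>(x, t). f x t) ` (D \<times> {0..})" by force
    with K show "norm (f x t) \<le> max 0 K" by fastforce
  qed simp
qed

lemma A_field_bounded:
  fixes u :: "'n::finite field"
  assumes "bounded_partials D u"
  obtains K where "0 \<le> K" "\<And>x t. x \<in> D \<Longrightarrow> 0 \<le> t \<Longrightarrow> norm (A_field \<gamma> \<epsilon> u x t) \<le> K"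
proof -
  have b: "bounded_field D (dxs is u)" if "length is \<le> 3" for "is"
    using assms that by (auto simp: bounded_partials_def)
  obtain K0 where K0: "0 \<le> K0" "\<And>x t. x \<in> D \<Longrightarrow> 0 \<le> t \<Longrightarrow> norm (u x t) \<le> K0"
    using bounded_fieldE[OF b[of "[]"]] by auto
  have "\<exists>K\<ge>0. \<forall>x\<in>D. \<forall>t\<ge>0. norm (dx i (dx i u) x t) \<le> K" for i
    by (rule bounded_fieldE[OF b[of "[i, i]"]]) auto
  then obtain K where K: "\<And>i. 0 \<le> K i" "\<And>i x t. x \<in> D \<Longrightarrow> 0 \<le> t \<Longrightarrow> norm (dx i (dx i u) x t) \<le> K i"
    by metis
  show ?thesis
  proof (rule that[of "K0 + \<bar>\<gamma> * \<epsilon> / 6\<bar> * (\<Sum>i\<in>UNIV. K i)"])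
    show "0 \<le> K0 + \<bar>\<gamma> * \<epsilon> / 6\<bar> * (\<Sum>i\<in>UNIV. K i)"
      by (intro add_nonneg_nonneg mult_nonneg_nonneg sum_nonneg K0 K) auto
    fix x t assume xt: "x \<in> D" "0 \<le> (t::real)"
    have "norm (laplacian u x t) \<le> (\<Sum>i\<in>UNIV. K i)"
      unfolding laplacian_def by (rule order_trans[OF norm_sum sum_mono]) (rule K(2)[OF xt])
    then have "norm ((\<gamma> * \<epsilon> / 6) *\<^sub>R laplacian u x t) \<le> \<bar>\<gamma> * \<epsilon> / 6\<bar> * (\<Sum>i\<in>UNIV. K i)"
      unfolding norm_scaleR by (rule mult_left_mono) simp
    then show "norm (A_field \<gamma> \<epsilon> u x t) \<le> K0 + \<bar>\<gamma> * \<epsilon> / 6\<bar> * (\<Sum>i\<in>UNIV. K i)"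
      unfolding A_field_def by (rule norm_triangle_mono[OF K0(2)[OF xt]])
  qed
qed

lemma vector_sup_norm_leD:
  assumes "vector_sup_norm D f \<le> ereal L" "x \<in> D" "0 \<le> t"
  shows "norm (f x t) \<le> L"
  using assms unfolding vector_sup_norm_def SUP_le_iff by force

lemma matrix_sup_norm_leD:
  assumes "matrix_sup_norm D F \<le> ereal L" "x \<in> D" "0 \<le> t"
  shows "norm (F x t *v v) \<le> L * norm v"
proof -
  have "onorm ((*v) (F x t)) \<le> L"
    using assms unfolding matrix_sup_norm_def SUP_le_iff by force
  then show ?thesis
    by (meson matrix_vector_mul_bounded_linear mult_right_mono norm_ge_zero onorm order_trans)
qed

lemma time_interval_down_closed: "T \<in> time_interval \<delta> \<Longrightarrow> t \<in> {0..T} \<Longrightarrow> t \<in> time_interval \<delta>"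
  unfolding time_interval_def by (auto intro: le_less_trans[of "ereal t" "ereal T"])

context laplace_kernel
begin

section \<open>Norm estimates for abstract coefficient fields\<close>

context
  fixes D :: "(real ^ 'n::finite) set" and t0 \<epsilon> L_B L_M :: real
    and A B :: "'n field" and M :: "real ^ 'n \<Rightarrow> real \<Rightarrow> real ^ 'n ^ 'n"
    and y0 w0 :: "real ^ 'n" and \<delta> :: ereal and y w :: "real \<Rightarrow> real ^ 'n"
  assumes t0: "0 \<le> t0" and eps: "0 \<le> \<epsilon>" and L_nonneg: "0 \<le> L_B" "0 \<le> L_M"
    and L_B: "vector_sup_norm D B \<le> ereal L_B" and L_M: "matrix_sup_norm D M \<le> ereal L_M"
    and sol: "mild_solution D t0 \<epsilon> \<psi> A M B y0 w0 \<delta> y w"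
begin

abbreviation "forcing s \<equiv> - (M (y s) (t0 + \<epsilon> * s) *v w s) + B (y s) (t0 + \<epsilon> * s)"

lemma norm_forcing_le:
  assumes "s \<in> time_interval \<delta>" "norm (w s) \<le> q"
  shows "norm (forcing s) \<le> L_M * q + L_B"
proof -
  have "y s \<in> D" using sol assms(1) by (auto simp: mild_solution_def)
  moreover have "0 \<le> t0 + \<epsilon> * s"
    using t0 eps assms(1) by (auto simp: time_interval_def)
  ultimately have "norm (M (y s) (t0 + \<epsilon> * s) *v w s) \<le> L_M * norm (w s)"
    "norm (B (y s) (t0 + \<epsilon> * s)) \<le> L_B"
    using matrix_sup_norm_leD[OF L_M] vector_sup_norm_leD[OF L_B] by auto
  moreover have "L_M * norm (w s) \<le> L_M * q"
    using assms(2) L_nonneg(2) by (rule mult_left_mono)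
  ultimately show ?thesis
    using norm_triangle_ineq[of "- (M (y s) (t0 + \<epsilon> * s) *v w s)" "B (y s) (t0 + \<epsilon> * s)"] by simp
qed

text \<open>The majorant \<open>h\<close> is left free because it is chosen twice: from a continuous
  bound on |w| in the renewal step, and as a merely integrable function for the crude local
  bound.\<close>

lemma norm_mild_solution_le:
  assumes t: "t \<in> time_interval \<delta>"
    and h: "h integrable_on {0..t}" "\<And>s. s \<in> {0..t} \<Longrightarrow> \<psi> (t - s) * norm (forcing s) \<le> h s"
  shows "norm (w t) \<le> \<psi> t * norm w0 + \<epsilon> * integral {0..t} h"
proof -
  have "0 \<le> t" using t by (simp add: time_interval_def)
  have "norm (integral {0..t} (\<lambda>s. \<psi> (t - s) *\<^sub>R forcing s)) \<le> integral {0..t} h"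
  proof (rule Henstock_Kurzweil_Integration.integral_norm_bound_integral)
    show "(\<lambda>s. \<psi> (t - s) *\<^sub>R forcing s) integrable_on {0..t}"
      using sol t set_lebesgue_integral_eq_integral(1) unfolding mild_solution_def by blast
    fix s assume "s \<in> {0..t}"
    with h(2)[OF this] show "norm (\<psi> (t - s) *\<^sub>R forcing s) \<le> h s"
      by (simp add: psi_nonneg)
  qed (rule h(1))
  then have "norm (\<epsilon> *\<^sub>R integral {0..t} (\<lambda>s. \<psi> (t - s) *\<^sub>R forcing s)) \<le> \<epsilon> * integral {0..t} h"
    using eps by (simp add: mult_left_mono)
  moreover have "norm (\<psi> t *\<^sub>R w0) = \<psi> t * norm w0"
    using psi_nonneg[OF \<open>0 \<le> t\<close>] by simp
  moreover have "w t = \<psi> t *\<^sub>R w0 + \<epsilon> *\<^sub>R integral {0..t} (\<lambda>s. \<psi> (t - s) *\<^sub>R forcing s)"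
    using sol t unfolding mild_solution_def by blast
  then have "norm (w t) \<le> norm (\<psi> t *\<^sub>R w0)
      + norm (\<epsilon> *\<^sub>R integral {0..t} (\<lambda>s. \<psi> (t - s) *\<^sub>R forcing s))"
    by (simp only: norm_triangle_ineq)
  ultimately show ?thesis by linarith
qed

text \<open>Supplies the premise \<open>renewal\<close> of the iteration. Since \<open>q\<close> is
  continuous, its convolution with \<psi> exists and commutes, with no demand on |w| itself.\<close>

lemma mild_solution_renewal:
  assumes q: "continuous_on {0..} q" and t: "t \<in> time_interval \<delta>"
    and wq: "\<And>s. s \<in> {0..t} \<Longrightarrow> norm (w s) \<le> q s"
  shows "norm (w t) \<le> norm w0 * \<psi> t + \<epsilon> * (L_M * conv q \<psi> t + L_B * integral {0..t} \<psi>)"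
proof -
  have "((\<lambda>s. L_M * (\<psi> (t - s) * q s) + L_B * (\<psi> (t - s) * 1)) has_integral
      (L_M * conv \<psi> q t + L_B * conv \<psi> (\<lambda>_. 1) t)) {0..t}"
    unfolding conv_def
    by (intro has_integral_add has_integral_mult_right integrable_integral conv_integrable
        psi_continuous q continuous_on_const)
  moreover have "conv \<psi> (\<lambda>_. 1) t = integral {0..t} \<psi>"
    using conv_commute[of \<psi> "\<lambda>_. 1" t] psi_continuous by (simp add: conv_def)
  moreover have "conv \<psi> q t = conv q \<psi> t"
    by (intro conv_commute psi_continuous q)
  ultimately have h: "((\<lambda>s. \<psi> (t - s) * (L_M * q s + L_B)) has_integral
      (L_M * conv q \<psi> t + L_B * integral {0..t} \<psi>)) {0..t}"
    by (simp add: algebra_simps)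
  have "norm (w t) \<le> \<psi> t * norm w0 + \<epsilon> * integral {0..t} (\<lambda>s. \<psi> (t - s) * (L_M * q s + L_B))"
  proof (rule norm_mild_solution_le[OF t has_integral_integrable[OF h]])
    fix s assume s: "s \<in> {0..t}"
    then show "\<psi> (t - s) * norm (forcing s) \<le> \<psi> (t - s) * (L_M * q s + L_B)"
      by (intro mult_left_mono norm_forcing_le wq time_interval_down_closed[OF t] psi_nonneg) auto
  qed
  then show ?thesis
    by (simp only: integral_unique[OF h] mult.commute[of "\<psi> t"])
qed

text \<open>Integrability of \<open>w + A\<close> and boundedness of \<open>A\<close> bound the forcing by an integrable function.\<close>

lemma mild_solution_locally_bounded:
  assumes K: "0 \<le> K" "\<And>x t. x \<in> D \<Longrightarrow> 0 \<le> t \<Longrightarrow> norm (A x t) \<le> K" and T: "T \<in> time_interval \<delta>"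
  obtains C where "\<And>t. t \<in> {0..T} \<Longrightarrow> norm (w t) \<le> C"
proof -
  let ?h = "\<lambda>s. L_M * (norm (w s + A (y s) (t0 + \<epsilon> * s)) + K) + L_B"
  have "(\<lambda>s. w s + A (y s) (t0 + \<epsilon> * s)) absolutely_integrable_on {0..T}"
    using sol T by (auto simp: mild_solution_def)
  then have h: "?h integrable_on {0..T}"
    unfolding absolutely_integrable_on_def
    by (intro integrable_add integrable_on_mult_right) auto
  have hpos: "0 \<le> ?h s" for s
    using L_nonneg K(1) by simp
  show ?thesis
  proof (rule that)
    fix t assume t: "t \<in> {0..T}"
    note tI = time_interval_down_closed[OF T t]
    have ht: "?h integrable_on {0..t}"
      using integrable_on_subinterval[OF h] t by simp
    have "norm (w t) \<le> \<psi> t * norm w0 + \<epsilon> * integral {0..t} ?h"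
    proof (rule norm_mild_solution_le[OF tI ht])
      fix s assume s: "s \<in> {0..t}"
      note sI = time_interval_down_closed[OF tI s]
      have "y s \<in> D" using sol sI by (auto simp: mild_solution_def)
      moreover have "0 \<le> t0 + \<epsilon> * s"
        using t0 eps s by simp
      ultimately have "norm (A (y s) (t0 + \<epsilon> * s)) \<le> K" by (rule K(2))
      then have "norm (w s) \<le> norm (w s + A (y s) (t0 + \<epsilon> * s)) + K"
        using norm_triangle_ineq4[of "w s + A (y s) (t0 + \<epsilon> * s)" "A (y s) (t0 + \<epsilon> * s)"] by simp
      then have "norm (forcing s) \<le> ?h s"
        by (rule norm_forcing_le[OF sI])
      then show "\<psi> (t - s) * norm (forcing s) \<le> ?h s"
        using s psi_le_1[of "t - s"] psi_nonneg[of "t - s"]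
        by (intro order_trans[OF mult_left_le_one_le]) auto
    qed
    \<comment> \<open>Extending the nonnegative integrand to \<open>{0..T}\<close> makes the bound
      independent of t.\<close>
    also have "\<dots> \<le> 1 * norm w0 + \<epsilon> * integral {0..T} ?h"
      using t eps hpos by (intro add_mono mult_right_mono mult_left_mono integral_subset_le h ht psi_le_1) auto
    finally show "norm (w t) \<le> 1 * norm w0 + \<epsilon> * integral {0..T} ?h" .
  qed
qed

lemma mild_solution_bound:
  assumes K: "0 \<le> K" "\<And>x t. x \<in> D \<Longrightarrow> 0 \<le> t \<Longrightarrow> norm (A x t) \<le> K"
    and a: "\<epsilon> * L_M < 1" and t: "t \<in> time_interval \<delta>"
  shows "norm (w t) \<le> norm w0 * resolvent (\<epsilon> * L_M) t + \<epsilon> * L_B * integral {0..t} \<psi>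
       + \<epsilon>\<^sup>2 * L_M * L_B / (1 - \<epsilon> * L_M)"
proof -
  obtain C where C: "\<And>s. s \<in> {0..t} \<Longrightarrow> norm (w s) \<le> C"
    using mild_solution_locally_bounded[OF K t] by blast
  show ?thesis
  proof (rule renewal_bound[where T = t and v = "\<lambda>s. norm (w s)" and C = C])
    show "t \<in> {0..t}" using t by (simp add: time_interval_def)
  qed (use eps L_nonneg a C mild_solution_renewal time_interval_down_closed[OF t] in auto)
qed

end

end

theorem theorem3:
  fixes D :: "(real ^ 'n::finite) set"
    and u :: "real ^ 'n \<Rightarrow> real \<Rightarrow> real ^ 'n"
    and g y0 w0 :: "real ^ 'n"
    and y w :: "real \<Rightarrow> real ^ 'n"
    and \<psi> :: "real \<Rightarrow> real"
    and \<rho>f \<rho>p Rey R \<kappa> \<gamma> \<epsilon> t0 L_B L_M :: real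
    and \<delta> :: ereal
  assumes dim: "CARD('n) \<in> {2, 3}"
    and D: "open D"
    and t0: "0 \<le> t0"
    and densities: "0 < \<rho>f" "0 < \<rho>p"
    and Rey: "0 < Rey"
    and R: "R = 2 * \<rho>f / (\<rho>f + 2 * \<rho>p)"
    and \<kappa>: "\<kappa> = sqrt (9 * R / 2)"
    and \<gamma>: "\<gamma> = 9 * R / (2 * Rey)"
    and \<psi>_cont: "continuous_on {0..} \<psi>"
    and \<psi>_laplace: "has_laplace_transform \<psi> (\<lambda>s. 1 / (s + \<kappa> * sqrt s + 1))"
    and u: "bounded_partials D u"
    and L_pos: "0 < L_B" "0 < L_M"
    and L_B: "vector_sup_norm D (B_field R \<gamma> \<epsilon> g u) \<le> ereal L_B"
    and L_M: "matrix_sup_norm D (M_field \<gamma> \<epsilon> u) \<le> ereal L_M"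
    and \<epsilon>: "0 < \<epsilon>" "\<epsilon> < 1 / L_M"
    and \<delta>: "0 < \<delta>"
    and sol: "maximal_mild_solution D t0 \<epsilon> \<psi> (A_field \<gamma> \<epsilon> u) (M_field \<gamma> \<epsilon> u)
                (B_field R \<gamma> \<epsilon> g u) y0 w0 \<delta> y w"
  shows "(\<forall>\<tau>\<in>time_interval \<delta>.
            norm (w \<tau>) \<le> norm w0 * (\<Sum>j. (\<epsilon> * L_M) ^ j * conv_power \<psi> (Suc j) \<tau>)
                          + \<epsilon> * L_B * (1 - phi \<psi> \<tau>) + \<epsilon>\<^sup>2 * L_M * L_B / (1 - \<epsilon> * L_M))
         \<and> uniformly_convergent_on {0..}
             (\<lambda>N \<tau>. \<Sum>j<N. (\<epsilon> * L_M) ^ j * conv_power \<psi> (Suc j) \<tau>)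
         \<and> bounded ((\<lambda>\<tau>. \<Sum>j. (\<epsilon> * L_M) ^ j * conv_power \<psi> (Suc j) \<tau>) ` {0..})
         \<and> bounded (w ` time_interval \<delta>)
         \<and> (SUP \<tau>\<in>time_interval \<delta>. norm (w \<tau>)) \<le> (norm w0 + \<epsilon> * L_B) / (1 - \<epsilon> * L_M)
         \<and> (\<delta> = \<infinity> \<longrightarrow>
              Limsup at_top (\<lambda>\<tau>. ereal (norm (w \<tau>))) \<le> ereal (\<epsilon> * L_B / (1 - \<epsilon> * L_M)))"
proof -
  have "0 \<le> \<kappa>"
    using densities by (simp add: \<kappa> R)
  interpret laplace_kernel \<kappa> \<psi>
  proof unfold_locales
  qed fact+
  define a where "a = \<epsilon> * L_M"
  have a: "0 \<le> a" "a < 1"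
    using \<epsilon> L_pos by (auto simp: a_def field_simps)
  have mild: "mild_solution D t0 \<epsilon> \<psi> (A_field \<gamma> \<epsilon> u) (M_field \<gamma> \<epsilon> u) (B_field R \<gamma> \<epsilon> g u) y0 w0 \<delta> y w"
    using sol by (simp add: maximal_mild_solution_def)
  obtain K where K: "0 \<le> K" "\<And>x t. x \<in> D \<Longrightarrow> 0 \<le> t \<Longrightarrow> norm (A_field \<gamma> \<epsilon> u x t) \<le> K"
    using A_field_bounded[OF u] by blast
  define c where "c = \<epsilon>\<^sup>2 * L_M * L_B / (1 - a)"
  have main: "norm (w t) \<le> norm w0 * resolvent a t + \<epsilon> * L_B * integral {0..t} \<psi> + c"
    if "t \<in> time_interval \<delta>" for t
    using mild_solution_bound[OF t0 _ _ _ L_B L_M mild K _ that] \<epsilon> L_pos a by (simp add: a_def c_def)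
  \<comment> \<open>With the integral of \<psi> at most 1, both source terms merge into one
    constant. The supremum bound then follows from resolvent \<le> 1/(1 - a), the limit superior
    from decay of the resolvent.\<close>
  have sum: "\<epsilon> * L_B + c = \<epsilon> * L_B / (1 - a)"
    using a by (simp add: c_def a_def field_simps power2_eq_square)
  have lim_bound: "norm (w t) \<le> norm w0 * resolvent a t + \<epsilon> * L_B / (1 - a)"
    if "t \<in> time_interval \<delta>" for t
  proof -
    have "\<epsilon> * L_B * integral {0..t} \<psi> \<le> \<epsilon> * L_B"
      using that \<epsilon> L_pos integral_psi_le_1[of t] by (simp add: time_interval_def mult_left_le)
    with main[OF that] sum show ?thesis by linarith
  qed
  have bound: "norm (w t) \<le> (norm w0 + \<epsilon> * L_B) / (1 - a)" if "t \<in> time_interval \<delta>" for t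
  proof -
    have "norm w0 * resolvent a t \<le> norm w0 * (1 / (1 - a))"
      using that by (intro mult_left_mono resolvent_bounds a) (auto simp: time_interval_def)
    with lim_bound[OF that] show ?thesis by (simp add: add_divide_distrib)
  qed
  have i: "\<forall>\<tau>\<in>time_interval \<delta>. norm (w \<tau>) \<le> norm w0 * (\<Sum>j. a ^ j * conv_power \<psi> (Suc j) \<tau>)
      + \<epsilon> * L_B * (1 - phi \<psi> \<tau>) + \<epsilon>\<^sup>2 * L_M * L_B / (1 - a)"
    using main by (simp add: phi_def resolvent_def c_def)
  have ii: "uniformly_convergent_on {0..} (\<lambda>N \<tau>. \<Sum>j<N. a ^ j * conv_power \<psi> (Suc j) \<tau>)"
    using uniform_limit_resolvent_sum[OF a]
    unfolding uniformly_convergent_on_def resolvent_sum_def[abs_def] by blast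
  have iii: "bounded ((\<lambda>\<tau>. \<Sum>j. a ^ j * conv_power \<psi> (Suc j) \<tau>) ` {0..})"
    unfolding bounded_iff resolvent_def[symmetric]
    using resolvent_bounds[OF a] by (intro exI[of _ "1 / (1 - a)"]) auto
  have iv: "bounded (w ` time_interval \<delta>)"
    unfolding bounded_iff using bound by blast
  \<comment> \<open>A real supremum is bounded by a common upper bound only over a nonempty
    set.\<close>
  have "0 \<in> time_interval \<delta>"
    using \<delta> by (simp add: time_interval_def zero_ereal_def)
  then have v: "(SUP \<tau>\<in>time_interval \<delta>. norm (w \<tau>)) \<le> (norm w0 + \<epsilon> * L_B) / (1 - a)"
    by (intro cSUP_least bound) auto
  have vi: "Limsup at_top (\<lambda>\<tau>. ereal (norm (w \<tau>))) \<le> ereal (\<epsilon> * L_B / (1 - a))" if "\<delta> = \<infinity>"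
  proof -
    have "((\<lambda>t. norm w0 * resolvent a t + \<epsilon> * L_B / (1 - a)) \<longlongrightarrow> norm w0 * 0 + \<epsilon> * L_B / (1 - a)) at_top"
      by (intro tendsto_intros resolvent_tendsto_0 a)
    then have "((\<lambda>t. ereal (norm w0 * resolvent a t + \<epsilon> * L_B / (1 - a))) \<longlongrightarrow> ereal (\<epsilon> * L_B / (1 - a))) at_top"
      by simp
    from lim_imp_Limsup[OF _ this]
    have "Limsup at_top (\<lambda>t. ereal (norm w0 * resolvent a t + \<epsilon> * L_B / (1 - a))) = ereal (\<epsilon> * L_B / (1 - a))"
      by simp
    \<comment> \<open>The comparison starts at 0, since \<open>w\<close> is arbitrary at negative
      times.\<close>
    moreover have "eventually (\<lambda>t. ereal (norm (w t)) \<le> ereal (norm w0 * resolvent a t + \<epsilon> * L_B / (1 - a))) at_top"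
      using eventually_ge_at_top[of 0]
      by eventually_elim (use lim_bound that in \<open>simp add: time_interval_def\<close>)
    ultimately show ?thesis
      using Limsup_mono by metis
  qed
  show ?thesis
    using i ii iii iv v vi unfolding a_def by blast
qed

end
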